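(* Let $D$ be an integral domain. The following are equivalent: (1) $D$ is a Jaffard domain; (2) $D[X]$ is a Jaffard domain and $\dim(D[X])=1+\dim(D)$; (3) $D[X]_A$ is a Jaffard domain and $\dim(D[X])=1+\dim(D)$; (4) $D[X]_U$ is a Jaffard domain and $\dim(D[X])=1+\dim(D)$; (5) $D[X]_N$ is a Jaffard domain and $\dim(D[X])=1+\dim(D)$.
   Context: $X$ is an indeterminate over $D$; $A=\{f\in D[X]\mid f(0)=1\}$, $U=\{f\in D[X]\mid f\text{ monic}\}$, $N=\{f\in D[X]\mid c(f)=D\}$ with $c(f)$ the ideal generated by the coefficients of $f$; $D[X]_A$, $D[X]_U$, $D[X]_N$ are the corresponding localizations. $\dim$ denotes Krull dimension. The valuative dimension $\dim_v(D)$ is the supremum of the Krull dimensions of the valuation overrings of $D$; $D$ is a Jaffard domain if $\dim_v(D)<\infty$ and $\dim_v(D)=\dim(D)$. *)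

theory Defs
  imports "HOL-Computational_Algebra.Polynomial" "HOL-Computational_Algebra.Fraction_Field"
          "HOL-Library.Extended_Nat"
begin

text \<open>Commutative rings with identity that are integral domains are represented as
subrings of a field (every integral domain is such a subring, e.g. of its
quotient field).  All notions below are relative to a subring R of a field of
type 'f.\<close>

definition is_subring :: "'f::field set \<Rightarrow> bool" where
  "is_subring R \<longleftrightarrow> 0 \<in> R \<and> 1 \<in> R \<and>
     (\<forall>a\<in>R. \<forall>b\<in>R. a + b \<in> R \<and> a - b \<in> R \<and> a * b \<in> R)"

definition is_ideal_in :: "'f::field set \<Rightarrow> 'f set \<Rightarrow> bool" where
  "is_ideal_in R I \<longleftrightarrow> I \<subseteq> R \<and> 0 \<in> I \<and>
     (\<forall>a\<in>I. \<forall>b\<in>I. a + b \<in> I) \<and> (\<forall>r\<in>R. \<forall>a\<in>I. r * a \<in> I)"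

definition is_prime_in :: "'f::field set \<Rightarrow> 'f set \<Rightarrow> bool" where
  "is_prime_in R P \<longleftrightarrow> is_ideal_in R P \<and> P \<noteq> R \<and>
     (\<forall>a\<in>R. \<forall>b\<in>R. a * b \<in> P \<longrightarrow> a \<in> P \<or> b \<in> P)"

definition krull_dim :: "'f::field set \<Rightarrow> enat" where
  "krull_dim R = Sup {enat n | n. \<exists>P :: nat \<Rightarrow> 'f set.
      (\<forall>i\<le>n. is_prime_in R (P i)) \<and> (\<forall>i<n. P i \<subset> P (Suc i))}"

definition quot_field :: "'f::field set \<Rightarrow> 'f set" where
  "quot_field R = {a / b | a b. a \<in> R \<and> b \<in> R \<and> b \<noteq> 0}"

definition is_valuation_domain :: "'f::field set \<Rightarrow> bool" where
  "is_valuation_domain V \<longleftrightarrow> is_subring V \<and>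
     (\<forall>x\<in>quot_field V. x \<noteq> 0 \<longrightarrow> x \<in> V \<or> inverse x \<in> V)"

definition is_overring :: "'f::field set \<Rightarrow> 'f set \<Rightarrow> bool" where
  "is_overring R V \<longleftrightarrow> is_subring V \<and> R \<subseteq> V \<and> V \<subseteq> quot_field R"

definition valuative_dim :: "'f::field set \<Rightarrow> enat" where
  "valuative_dim R = Sup {krull_dim V | V. is_overring R V \<and> is_valuation_domain V}"

definition jaffard :: "'f::field set \<Rightarrow> bool" where
  "jaffard R \<longleftrightarrow> valuative_dim R < \<infinity> \<and> valuative_dim R = krull_dim R"

definition polys_over :: "'k::field set \<Rightarrow> 'k poly set" where
  "polys_over R = {p. \<forall>i. coeff p i \<in> R}"

definition poly_ring :: "'k::field set \<Rightarrow> 'k poly fract set" where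
  "poly_ring R = {Fract p 1 | p. p \<in> polys_over R}"

definition poly_loc :: "'k::field set \<Rightarrow> 'k poly set \<Rightarrow> 'k poly fract set" where
  "poly_loc R S = {Fract f g | f g. f \<in> polys_over R \<and> g \<in> S}"

definition A_set :: "'k::field set \<Rightarrow> 'k poly set" where
  "A_set R = {f \<in> polys_over R. poly f 0 = 1}"

definition U_set :: "'k::field set \<Rightarrow> 'k poly set" where
  "U_set R = {f \<in> polys_over R. lead_coeff f = 1}"

definition content_ideal :: "'k::field set \<Rightarrow> 'k poly \<Rightarrow> 'k set" where
  "content_ideal R f = {\<Sum>i\<le>degree f. r i * coeff f i | r. \<forall>i. r i \<in> R}"

definition N_set :: "'k::field set \<Rightarrow> 'k poly set" where
  "N_set R = {f \<in> polys_over R. content_ideal R f = R}"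

end

theory Submission
  imports Defs "HOL-Computational_Algebra.Polynomial_Factorial"
begin

text \<open>Everything rests on two comparisons of valuative dimensions. If \<open>S\<close> consists of polynomials
  with constant term 1, then \<open>dim\<^sub>v D[X]\<^sub>S = dim\<^sub>v D + 1\<close>; if \<open>S\<close> lies between \<open>U\<close> and \<open>N\<close>, then
  \<open>dim\<^sub>v D[X]\<^sub>S = dim\<^sub>v D\<close>. Lower bounds come from lifting prime chains of \<open>V[X]\<close>, \<open>V\<close> a valuation
  overring of \<open>D\<close>, to valuation rings. Upper bounds come from contracting valuation rings of \<open>K(X)\<close>
  to \<open>K\<close>: as \<open>K(X)\<close> has transcendence degree 1 over \<open>K\<close>, at most one step of a prime chain
  collapses. When all monic polynomials are units in \<open>W\<close>, the bound improves by one, because \<open>W\<close>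
  is properly refined by a valuation ring having \<open>1/X\<close> as a nonunit.
  The implication back to \<open>D\<close> also needs \<open>dim D[X]\<^sub>S + 1 \<le> dim D[X]\<close> for \<open>U \<subseteq> S\<close>: reversing
  polynomials (\<open>X \<mapsto> 1/X\<close>) turns a chain of primes avoiding \<open>U\<close> into one that can be prolonged by a
  prime containing \<open>X\<close>.\<close>

text \<open>Values are compared without value groups: \<open>a / b \<in> W\<close> says that
  \<open>a\<close> has at least the value of \<open>b\<close>, and equal value means that both
  quotients lie in \<open>W\<close>. Dimensions may be infinite, so every inequality between them is
  proved by transforming chains of arbitrary finite length \<open>n\<close>. The two families of
  sets differ by one because of \<open>X\<close>. Polynomials with constant term 1 avoid the prime
  of all polynomials with constant term in a given prime \<open>P\<close>, which sits above
  \<open>P[X]\<close>; if \<open>S\<close> contains the monic polynomials, then \<open>X\<close>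
  becomes a unit and this extra prime is lost. In that case the plain bound
  \<open>dim D[X]_S \<le> dim D[X]\<close> would be too weak by one to recover \<open>D\<close>,
  which is why reversal is needed. The refinement by \<open>1/X\<close> is an integrality criterion:
  for \<open>D[X] \<subseteq> W\<close>, all monic polynomials are units of \<open>W\<close> exactly
  if the residue of \<open>X\<close> is not integral over the image of \<open>D\<close>, and then
  \<open>1/X\<close> generates a proper ideal over that image.\<close>

definition is_subfield :: "'f::field set \<Rightarrow> bool" where
  "is_subfield F \<longleftrightarrow> is_subring F \<and> (\<forall>x\<in>F. inverse x \<in> F)"

text \<open>The field is a parameter because valuation rings of \<open>K\<close>, of
  \<open>K(X)\<close> and of the whole type all occur, and the type may be larger than the quotient
  field at hand. A subfield \<open>F\<close> counts as a valuation ring of itself.\<close>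

definition valuation_ring_of :: "'f::field set \<Rightarrow> 'f set \<Rightarrow> bool" where
  "valuation_ring_of F V \<longleftrightarrow> is_subring V \<and> V \<subseteq> F \<and> (\<forall>x\<in>F. x \<noteq> 0 \<longrightarrow> x \<in> V \<or> inverse x \<in> V)"

text \<open>The maximal ideal, when \<open>V\<close> is a valuation ring. Zero is named separately
  since \<open>inverse 0 = 0\<close> lies in every subring.\<close>

definition nonunits :: "'f::field set \<Rightarrow> 'f set" where
  "nonunits V = {x \<in> V. x = 0 \<or> inverse x \<notin> V}"

text \<open>The number \<open>n\<close> counts strict inclusions between \<open>n + 1\<close>
  primes. Values of \<open>P\<close> beyond \<open>n\<close> are unconstrained, so a chain can be
  prolonged by a function update at \<open>Suc n\<close>.\<close>

definition prime_chain :: "'f::field set \<Rightarrow> nat \<Rightarrow> (nat \<Rightarrow> 'f set) \<Rightarrow> bool" where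
  "prime_chain R n P \<longleftrightarrow> (\<forall>i\<le>n. is_prime_in R (P i)) \<and> (\<forall>i<n. P i \<subset> P (Suc i))"

subsection \<open>Subrings, ideals and localizations inside a field\<close>

lemma subringD:
  assumes "is_subring R"
  shows "0 \<in> R" "1 \<in> R" "\<And>a b. a \<in> R \<Longrightarrow> b \<in> R \<Longrightarrow> a + b \<in> R"
    "\<And>a b. a \<in> R \<Longrightarrow> b \<in> R \<Longrightarrow> a - b \<in> R" "\<And>a b. a \<in> R \<Longrightarrow> b \<in> R \<Longrightarrow> a * b \<in> R"
    "\<And>a. a \<in> R \<Longrightarrow> - a \<in> R"
proof -
  show *: "0 \<in> R" "1 \<in> R" "\<And>a b. a \<in> R \<Longrightarrow> b \<in> R \<Longrightarrow> a + b \<in> R"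
    "\<And>a b. a \<in> R \<Longrightarrow> b \<in> R \<Longrightarrow> a - b \<in> R" "\<And>a b. a \<in> R \<Longrightarrow> b \<in> R \<Longrightarrow> a * b \<in> R"
    using assms unfolding is_subring_def by blast+
  fix a assume "a \<in> R"
  then have "0 - a \<in> R" using * by blast
  then show "- a \<in> R" by simp
qed

lemma subring_power: "is_subring R \<Longrightarrow> a \<in> R \<Longrightarrow> a ^ n \<in> R"
  by (induction n) (auto intro: subringD)

lemma subring_sum: "is_subring R \<Longrightarrow> (\<And>i. i \<in> S \<Longrightarrow> f i \<in> R) \<Longrightarrow> sum f S \<in> R"
  by (induction S rule: infinite_finite_induct) (auto intro: subringD)

lemma idealD:
  assumes "is_ideal_in R I"
  shows "0 \<in> I" "\<And>a. a \<in> I \<Longrightarrow> a \<in> R" "\<And>a b. a \<in> I \<Longrightarrow> b \<in> I \<Longrightarrow> a + b \<in> I"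
    "\<And>a r. r \<in> R \<Longrightarrow> a \<in> I \<Longrightarrow> r * a \<in> I" "\<And>a r. a \<in> I \<Longrightarrow> r \<in> R \<Longrightarrow> a * r \<in> I"
proof -
  show "0 \<in> I" "\<And>a. a \<in> I \<Longrightarrow> a \<in> R" "\<And>a b. a \<in> I \<Longrightarrow> b \<in> I \<Longrightarrow> a + b \<in> I"
    and *: "\<And>a r. r \<in> R \<Longrightarrow> a \<in> I \<Longrightarrow> r * a \<in> I"
    using assms unfolding is_ideal_in_def by auto
  show "\<And>a r. a \<in> I \<Longrightarrow> r \<in> R \<Longrightarrow> a * r \<in> I" using * by (metis mult.commute)
qed

lemma ideal_uminus:
  assumes "is_subring R" "is_ideal_in R I" "a \<in> I"
  shows "- a \<in> I"
proof -
  have "(- 1) * a \<in> I" using assms by (intro idealD(4)) (auto intro: subringD)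
  then show ?thesis by simp
qed

lemma ideal_diff:
  assumes "is_subring R" "is_ideal_in R I" "a \<in> I" "b \<in> I"
  shows "a - b \<in> I"
  using idealD(3)[OF assms(2,3) ideal_uminus[OF assms(1,2,4)]] by simp

lemma ideal_sum: "is_ideal_in R I \<Longrightarrow> (\<And>i. i \<in> S \<Longrightarrow> f i \<in> I) \<Longrightarrow> sum f S \<in> I"
  by (induction S rule: infinite_finite_induct) (auto intro: idealD)

lemma primeD:
  assumes "is_prime_in R P"
  shows "is_ideal_in R P" "\<And>a b. a \<in> R \<Longrightarrow> b \<in> R \<Longrightarrow> a * b \<in> P \<Longrightarrow> a \<in> P \<or> b \<in> P"
    "0 \<in> P" "\<And>a. a \<in> P \<Longrightarrow> a \<in> R" "1 \<notin> P"
proof -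
  show I: "is_ideal_in R P" and "\<And>a b. a \<in> R \<Longrightarrow> b \<in> R \<Longrightarrow> a * b \<in> P \<Longrightarrow> a \<in> P \<or> b \<in> P"
    using assms unfolding is_prime_in_def by blast+
  show "0 \<in> P" "\<And>a. a \<in> P \<Longrightarrow> a \<in> R" using idealD[OF I] by blast+
  show "1 \<notin> P"
  proof
    assume "1 \<in> P"
    then have "R \<subseteq> P" using idealD(4)[OF I, of _ 1] by auto
    then show False using assms idealD(2)[OF I] unfolding is_prime_in_def by blast
  qed
qed

lemma primeI:
  assumes "is_ideal_in R P" "1 \<in> R" "1 \<notin> P"
    "\<And>a b. a \<in> R \<Longrightarrow> b \<in> R \<Longrightarrow> a * b \<in> P \<Longrightarrow> a \<in> P \<or> b \<in> P"
  shows "is_prime_in R P"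
  using assms unfolding is_prime_in_def by blast

lemma prime_power:
  assumes "is_subring R" "is_prime_in R P" "a \<in> R" "a ^ n \<in> P"
  shows "a \<in> P"
  using assms(4)
proof (induction n)
  case 0
  then show ?case using primeD(5)[OF assms(2)] by simp
next
  case (Suc n)
  then show ?case using primeD(2)[OF assms(2), of a "a ^ n"] assms subring_power by auto
qed

lemma prime_zero: "is_subring R \<Longrightarrow> is_prime_in R {0}"
  by (intro primeI) (auto simp: is_ideal_in_def intro: subringD)

lemma prime_contract:
  assumes "is_subring R" "is_subring T" "R \<subseteq> T" "is_prime_in T P"
  shows "is_prime_in R (P \<inter> R)"
proof (rule primeI)
  show "is_ideal_in R (P \<inter> R)"
    using idealD(1,3)[OF primeD(1)[OF assms(4)]] idealD(4)[OF primeD(1)[OF assms(4)]] subringD[OF assms(1)] assms(3)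
    unfolding is_ideal_in_def by (auto simp: subset_iff)
  show "1 \<in> R" "1 \<notin> P \<inter> R" using subringD[OF assms(1)] primeD[OF assms(4)] by blast+
  fix a b assume "a \<in> R" "b \<in> R" "a * b \<in> P \<inter> R"
  then show "a \<in> P \<inter> R \<or> b \<in> P \<inter> R" using primeD(2)[OF assms(4), of a b] assms(3) by blast
qed

lemma subfieldD:
  assumes "is_subfield F"
  shows "is_subring F" "\<And>x. x \<in> F \<Longrightarrow> inverse x \<in> F" "\<And>x y. x \<in> F \<Longrightarrow> y \<in> F \<Longrightarrow> x / y \<in> F"
  using assms subringD(5)[of F] unfolding is_subfield_def by (auto simp: divide_inverse)

lemma subfield_UNIV: "is_subfield UNIV"
  by (simp add: is_subfield_def is_subring_def)

section \<open>Rings of fractions and their primes\<close>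

text \<open>The first argument is also instantiated with an ideal; the result is then the extended
  ideal in the ring of fractions.\<close>

definition localization :: "'f::field set \<Rightarrow> 'f set \<Rightarrow> 'f set" where
  "localization R T = {a / b | a b. a \<in> R \<and> b \<in> T}"

definition mult_set :: "'f::field set \<Rightarrow> 'f set \<Rightarrow> bool" where
  "mult_set R T \<longleftrightarrow> T \<subseteq> R \<and> 0 \<notin> T \<and> 1 \<in> T \<and> (\<forall>a\<in>T. \<forall>b\<in>T. a * b \<in> T)"

lemma mult_setD:
  assumes "mult_set R T"
  shows "\<And>a. a \<in> T \<Longrightarrow> a \<in> R" "0 \<notin> T" "1 \<in> T" "\<And>a b. a \<in> T \<Longrightarrow> b \<in> T \<Longrightarrow> a * b \<in> T"
  using assms unfolding mult_set_def by auto

lemma localizationI: "a \<in> R \<Longrightarrow> b \<in> T \<Longrightarrow> a / b \<in> localization R T"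
  unfolding localization_def by blast

lemma localization_ring:
  assumes R: "is_subring R" and T: "mult_set R T"
  shows "is_subring (localization R T)" "R \<subseteq> localization R T"
proof -
  note D = subringD[OF R] and M = mult_setD[OF T]
  show sub: "R \<subseteq> localization R T"
  proof
    fix x assume "x \<in> R"
    then have "x / 1 \<in> localization R T" using M by (intro localizationI)
    then show "x \<in> localization R T" by simp
  qed
  show "is_subring (localization R T)"
    unfolding is_subring_def
  proof (intro conjI ballI)
    show "0 \<in> localization R T" "1 \<in> localization R T" using sub D by blast+
    fix x y assume "x \<in> localization R T" "y \<in> localization R T"
    then obtain a b c d where *: "x = a / b" "y = c / d" "a \<in> R" "b \<in> T" "c \<in> R" "d \<in> T"
      unfolding localization_def by blast
    have nz: "b \<noteq> 0" "d \<noteq> 0" using * M by auto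
    have "x + y = (a * d + c * b) / (b * d)" "x - y = (a * d - c * b) / (b * d)" "x * y = (a * c) / (b * d)"
      using nz * by (simp_all add: field_simps)
    then show "x + y \<in> localization R T" "x - y \<in> localization R T" "x * y \<in> localization R T"
      using * M D by (auto intro!: localizationI)
  qed
qed

lemma localization_ideal:
  assumes R: "is_subring R" and T: "mult_set R T" and I: "is_ideal_in R I"
  shows "is_ideal_in (localization R T) (localization I T)"
  unfolding is_ideal_in_def
proof (intro conjI ballI)
  note D = subringD[OF R] and M = mult_setD[OF T] and I' = idealD[OF I]
  show "localization I T \<subseteq> localization R T" unfolding localization_def using I' by blast
  have "0 / 1 \<in> localization I T" using M I' by (intro localizationI)
  then show "0 \<in> localization I T" by simp
  { fix x y assume "x \<in> localization I T" "y \<in> localization I T"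
    then obtain a b c d where *: "x = a / b" "y = c / d" "a \<in> I" "b \<in> T" "c \<in> I" "d \<in> T"
      unfolding localization_def by blast
    have nz: "b \<noteq> 0" "d \<noteq> 0" using * M by auto
    have "x + y = (a * d + c * b) / (b * d)" using nz * by (simp_all add: field_simps)
    then show "x + y \<in> localization I T" using * M I' by (auto intro!: localizationI) }
  { fix x y assume "x \<in> localization R T" "y \<in> localization I T"
    then obtain a b c d where *: "x = a / b" "y = c / d" "a \<in> R" "b \<in> T" "c \<in> I" "d \<in> T"
      unfolding localization_def by blast
    have "x * y = (a * c) / (b * d)" using * by simp
    then show "x * y \<in> localization I T" using * M I' by (auto intro!: localizationI) }
qed

text \<open>From \<open>x = a / b\<close> one gets \<open>x * b\<close> in \<open>P\<close> with
  \<open>b\<close> outside \<open>P\<close>. Hence distinct primes that miss \<open>T\<close> stay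
  distinct after localizing.\<close>

lemma localization_prime_mem:
  assumes R: "is_subring R" and T: "mult_set R T" and P: "is_prime_in R P" "P \<inter> T = {}"
    and x: "x \<in> R"
  shows "x \<in> localization P T \<longleftrightarrow> x \<in> P"
proof
  note M = mult_setD[OF T]
  assume "x \<in> localization P T"
  then obtain a b where *: "x = a / b" "a \<in> P" "b \<in> T" unfolding localization_def by blast
  then have "x * b \<in> P" using M by auto
  then show "x \<in> P" using primeD(2)[OF P(1), of x b] x * M P(2) by blast
next
  assume "x \<in> P"
  then have "x / 1 \<in> localization P T" using mult_setD[OF T] by (intro localizationI)
  then show "x \<in> localization P T" by simp
qed

lemma localization_prime:
  assumes R: "is_subring R" and T: "mult_set R T" and P: "is_prime_in R P" "P \<inter> T = {}"
  shows "is_prime_in (localization R T) (localization P T)"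
proof (rule primeI)
  note D = subringD[OF R] and M = mult_setD[OF T] and L = localization_ring[OF R T]
  show id: "is_ideal_in (localization R T) (localization P T)"
    using localization_ideal[OF R T primeD(1)[OF P(1)]] .
  show "1 \<in> localization R T" using L D by blast
  show "1 \<notin> localization P T" using localization_prime_mem[OF R T P] D primeD[OF P(1)] by blast
  fix x y assume "x \<in> localization R T" "y \<in> localization R T" and xy: "x * y \<in> localization P T"
  then obtain a b c d where *: "x = a / b" "y = c / d" "a \<in> R" "b \<in> T" "c \<in> R" "d \<in> T"
    unfolding localization_def by blast
  have nz: "b \<noteq> 0" "d \<noteq> 0" using * M by auto
  have "(b * d) * (x * y) \<in> localization P T"
    using L(2) * M D by (intro idealD(4)[OF id] xy) blast
  moreover have "(b * d) * (x * y) = a * c" using * nz by simp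
  ultimately have "a * c \<in> P" using localization_prime_mem[OF R T P, of "a * c"] * D by auto
  then show "x \<in> localization P T \<or> y \<in> localization P T"
    using primeD(2)[OF P(1), of a c] * by (auto intro: localizationI)
qed

lemma prime_chain_localization:
  assumes R: "is_subring R" and T: "mult_set R T" and P: "prime_chain R n P" "\<And>i. i \<le> n \<Longrightarrow> P i \<inter> T = {}"
  shows "prime_chain (localization R T) n (\<lambda>i. localization (P i) T)"
  unfolding prime_chain_def
proof (intro conjI allI impI)
  fix i assume "i \<le> n"
  then show "is_prime_in (localization R T) (localization (P i) T)"
    using P by (intro localization_prime[OF R T]) (auto simp: prime_chain_def)
next
  fix i assume i: "i < n"
  then have s: "P i \<subset> P (Suc i)" and pr: "is_prime_in R (P i)" "is_prime_in R (P (Suc i))"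
    using P unfolding prime_chain_def by auto
  then obtain x where x: "x \<in> P (Suc i)" "x \<notin> P i" by blast
  have "x \<in> R" using x primeD[OF pr(2)] by blast
  then have "x \<in> localization (P (Suc i)) T" "x \<notin> localization (P i) T"
    using x localization_prime_mem[OF R T pr(2)] localization_prime_mem[OF R T pr(1)] P(2) i by auto
  moreover have "localization (P i) T \<subseteq> localization (P (Suc i)) T"
    using s unfolding localization_def by blast
  ultimately show "localization (P i) T \<subset> localization (P (Suc i)) T" by blast
qed

lemma localization_prime_disjoint:
  assumes R: "is_subring R" and T: "mult_set R T" and Q: "is_prime_in (localization R T) Q"
  shows "Q \<inter> T = {}"
proof (rule ccontr)
  assume "Q \<inter> T \<noteq> {}"
  then obtain t where t: "t \<in> Q" "t \<in> T" by blast
  have "1 / t \<in> localization R T" using t subringD[OF R] by (intro localizationI) auto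
  then have "(1 / t) * t \<in> Q" using idealD(4)[OF primeD(1)[OF Q]] t by blast
  moreover have "t \<noteq> 0" using t mult_setD[OF T] by auto
  ultimately show False using primeD(5)[OF Q] by simp
qed

text \<open>Strictness survives because a witness \<open>a / b\<close> differs from its numerator,
  an element of \<open>R\<close>, only by the unit \<open>b\<close>.\<close>

lemma prime_chain_contract_localization:
  assumes R: "is_subring R" and T: "mult_set R T" and Q: "prime_chain (localization R T) n Q"
  shows "prime_chain R n (\<lambda>i. Q i \<inter> R)"
  unfolding prime_chain_def
proof (intro conjI allI impI)
  note L = localization_ring[OF R T]
  fix i assume "i \<le> n"
  then show "is_prime_in R (Q i \<inter> R)"
    using Q by (intro prime_contract[OF R L]) (auto simp: prime_chain_def)
next
  note L = localization_ring[OF R T]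
  fix i assume i: "i < n"
  then have s: "Q i \<subset> Q (Suc i)" and pr: "is_prime_in (localization R T) (Q i)" "is_prime_in (localization R T) (Q (Suc i))"
    using Q unfolding prime_chain_def by auto
  then obtain x where x: "x \<in> Q (Suc i)" "x \<notin> Q i" by blast
  then obtain a b where *: "x = a / b" "a \<in> R" "b \<in> T" using primeD(4)[OF pr(2)] unfolding localization_def by blast
  have nz: "b \<noteq> 0" using * mult_setD[OF T] by auto
  have bL: "b \<in> localization R T" using * mult_setD[OF T] L by blast
  have "1 / b \<in> localization R T" using * subringD[OF R] by (intro localizationI) auto
  moreover have "a = b * x" "x = (1 / b) * a" using * nz by auto
  ultimately have "a \<in> Q (Suc i)" "a \<notin> Q i"
    using idealD(4)[OF primeD(1)[OF pr(2)], of b x] idealD(4)[OF primeD(1)[OF pr(1)], of "1 / b" a] bL x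
    by auto
  then show "Q i \<inter> R \<subset> Q (Suc i) \<inter> R" using s * by blast
qed

subsection \<open>Existence of valuation rings\<close>

lemma ideal_polys_mult:
  assumes R: "is_subring R" and I: "is_ideal_in R I" and "p \<in> polys_over R" "q \<in> polys_over I"
  shows "p * q \<in> polys_over I"
  using assms unfolding polys_over_def
  by (auto simp: coeff_mult intro!: ideal_sum[OF I] idealD(4)[OF I])

lemma polys_over_ring:
  assumes R: "is_subring R"
  shows "0 \<in> polys_over R" "1 \<in> polys_over R"
    "\<And>p q. p \<in> polys_over R \<Longrightarrow> q \<in> polys_over R \<Longrightarrow> p + q \<in> polys_over R"
    "\<And>p q. p \<in> polys_over R \<Longrightarrow> q \<in> polys_over R \<Longrightarrow> p - q \<in> polys_over R"
    "\<And>p q. p \<in> polys_over R \<Longrightarrow> q \<in> polys_over R \<Longrightarrow> p * q \<in> polys_over R"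
    "\<And>c n. c \<in> R \<Longrightarrow> monom c n \<in> polys_over R"
    "\<And>c. c \<in> R \<Longrightarrow> [:c:] \<in> polys_over R"
  using subringD[OF R] unfolding polys_over_def
  by (auto simp: coeff_mult coeff_1 coeff_pCons split: nat.split intro!: subring_sum[OF R])

lemma polys_over_ideal_add:
  assumes "is_ideal_in R I" "p \<in> polys_over I" "q \<in> polys_over I"
  shows "p + q \<in> polys_over I"
  using assms(2,3) idealD(3)[OF assms(1)] unfolding polys_over_def by simp

lemma poly_in_subring: "is_subring R \<Longrightarrow> p \<in> polys_over R \<Longrightarrow> x \<in> R \<Longrightarrow> poly p x \<in> R"
  unfolding poly_altdef polys_over_def by (auto intro!: subring_sum subringD(5) subring_power)

text \<open>\<open>A'\<close> is \<open>A[x]\<close> and \<open>J'\<close> is the ideal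
  \<open>J A[x]\<close>; the hypothesis \<open>no\<close> is precisely its properness. For a maximal
  pair this forces a relation \<open>poly p x = 1\<close> over \<open>J\<close> whenever
  \<open>x\<close> lies in the field but outside \<open>A\<close>.\<close>

lemma adjoin_pair:
  assumes A: "is_subring A" and J: "is_ideal_in A J"
    and no: "\<And>p. p \<in> polys_over J \<Longrightarrow> poly p x \<noteq> 1"
  defines "A' \<equiv> {poly p x | p. p \<in> polys_over A}" and "J' \<equiv> {poly p x | p. p \<in> polys_over J}"
  shows "is_subring A'" "is_ideal_in A' J'" "1 \<notin> J'" "A \<subseteq> A'" "J \<subseteq> J'" "x \<in> A'"
proof -
  note P = polys_over_ring[OF A]
  have JA: "polys_over J \<subseteq> polys_over A" using idealD[OF J] unfolding polys_over_def by blast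
  show "is_subring A'"
    unfolding is_subring_def
  proof (intro conjI ballI)
    show "0 \<in> A'" unfolding A'_def using P(1) by (force intro!: exI[of _ 0])
    show "1 \<in> A'" unfolding A'_def using P(2) by (force intro!: exI[of _ 1])
    fix a b assume "a \<in> A'" "b \<in> A'"
    then obtain p q where *: "a = poly p x" "b = poly q x" "p \<in> polys_over A" "q \<in> polys_over A"
      unfolding A'_def by blast
    then have "a + b = poly (p + q) x" "a - b = poly (p - q) x" "a * b = poly (p * q) x" by simp_all
    then show "a + b \<in> A'" "a - b \<in> A'" "a * b \<in> A'" unfolding A'_def using * P by blast+
  qed
  show "is_ideal_in A' J'"
    unfolding is_ideal_in_def
  proof (intro conjI ballI)
    show "J' \<subseteq> A'" unfolding A'_def J'_def using JA by blast
    have "0 \<in> polys_over J" using idealD[OF J] by (simp add: polys_over_def)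
    then show "0 \<in> J'" unfolding J'_def by (force intro!: exI[of _ 0])
    { fix a b assume "a \<in> J'" "b \<in> J'"
      then obtain p q where *: "a = poly p x" "b = poly q x" "p \<in> polys_over J" "q \<in> polys_over J"
        unfolding J'_def by blast
      then have "a + b = poly (p + q) x" by simp
      then show "a + b \<in> J'" unfolding J'_def using * polys_over_ideal_add[OF J] by blast }
    { fix a b assume "a \<in> A'" "b \<in> J'"
      then obtain p q where *: "a = poly p x" "b = poly q x" "p \<in> polys_over A" "q \<in> polys_over J"
        unfolding A'_def J'_def by blast
      then have "a * b = poly (p * q) x" by simp
      then show "a * b \<in> J'" unfolding J'_def using * ideal_polys_mult[OF A J] by blast }
  qed
  show "1 \<notin> J'" unfolding J'_def using no by force
  show "A \<subseteq> A'"
  proof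
    fix a assume "a \<in> A"
    then have "[:a:] \<in> polys_over A" "a = poly [:a:] x" using P by auto
    then show "a \<in> A'" unfolding A'_def by blast
  qed
  show "J \<subseteq> J'"
  proof
    fix a assume "a \<in> J"
    then have "[:a:] \<in> polys_over J" "a = poly [:a:] x"
      using idealD[OF J] by (auto simp: polys_over_def coeff_pCons split: nat.split)
    then show "a \<in> J'" unfolding J'_def by blast
  qed
  have "monom 1 1 \<in> polys_over A" "x = poly (monom 1 1) x" using P subringD[OF A] by (auto simp: poly_monom)
  then show "x \<in> A'" unfolding A'_def by blast
qed

text \<open>Zorn's lemma for pairs ordered by componentwise inclusion. Properness is recorded as
  \<open>1 \<notin> J\<close>, a condition that passes to unions of chains.\<close>

lemma maximal_pair_exists:
  assumes R: "is_subring R" "R \<subseteq> F" and I: "is_ideal_in R I" "1 \<notin> I"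
  obtains A J where "is_subring A" "A \<subseteq> F" "is_ideal_in A J" "1 \<notin> J" "R \<subseteq> A" "I \<subseteq> J"
    "\<And>A' J'. is_subring A' \<Longrightarrow> A' \<subseteq> F \<Longrightarrow> is_ideal_in A' J' \<Longrightarrow> 1 \<notin> J' \<Longrightarrow> A \<subseteq> A' \<Longrightarrow> J \<subseteq> J'
       \<Longrightarrow> A' = A \<and> J' = J"
proof -
  define S where "S = {(A, J). is_subring A \<and> A \<subseteq> F \<and> is_ideal_in A J \<and> 1 \<notin> J \<and> R \<subseteq> A \<and> I \<subseteq> J}"
  define le where "le = (\<lambda>(A :: 'a set, J :: 'a set) (A', J'). A \<subseteq> A' \<and> J \<subseteq> J')"
  have RI: "(R, I) \<in> S" using assms unfolding S_def by auto
  have po: "partial_order_on S (relation_of le S)"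
    by (rule partial_order_on_relation_ofI) (auto simp: le_def)
  have "\<exists>m\<in>S. \<forall>a\<in>S. le m a \<longrightarrow> a = m"
  proof (rule predicate_Zorn[OF po])
    fix C assume C: "C \<in> Chains (relation_of le S)"
    have CS: "C \<subseteq> S" using C unfolding Chains_def relation_of_def by blast
    have tot: "le a b \<or> le b a" if "a \<in> C" "b \<in> C" for a b
      using C that unfolding Chains_def relation_of_def by blast
    show "\<exists>u\<in>S. \<forall>a\<in>C. le a u"
    proof (cases "C = {}")
      case True
      then show ?thesis using RI by blast
    next
      case False
      define A where "A = \<Union> (fst ` C)"
      define J where "J = \<Union> (snd ` C)"
      \<comment> \<open>Any two members of the chain lie below a common one, so each closure
        property of the unions can be checked inside a single pair.\<close>
      have tot': "\<exists>r\<in>C. fst p \<subseteq> fst r \<and> snd p \<subseteq> snd r \<and> fst q \<subseteq> fst r \<and> snd q \<subseteq> snd r"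
        if "p \<in> C" "q \<in> C" for p q
      proof -
        have "le p q \<or> le q p" using tot that by blast
        then have "(fst p \<subseteq> fst q \<and> snd p \<subseteq> snd q) \<or> (fst q \<subseteq> fst p \<and> snd q \<subseteq> snd p)"
          unfolding le_def by (auto simp: case_prod_beta)
        then show ?thesis using that by (elim disjE) (intro bexI[of _ q] bexI[of _ p]; auto)+
      qed
      have up: "\<exists>p\<in>C. x \<in> fst p \<and> y \<in> fst p" if xy: "x \<in> A" "y \<in> A" for x y
      proof -
        obtain p q where "p \<in> C" "q \<in> C" "x \<in> fst p" "y \<in> fst q" using xy unfolding A_def by blast
        then show ?thesis using tot'[of p q] by blast
      qed
      have upJ: "\<exists>p\<in>C. x \<in> fst p \<and> y \<in> snd p" if xy: "x \<in> A" "y \<in> J" for x y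
      proof -
        obtain p q where "p \<in> C" "q \<in> C" "x \<in> fst p" "y \<in> snd q" using xy unfolding A_def J_def by blast
        then show ?thesis using tot'[of p q] by blast
      qed
      have upJJ: "\<exists>p\<in>C. x \<in> snd p \<and> y \<in> snd p" if xy: "x \<in> J" "y \<in> J" for x y
      proof -
        obtain p q where "p \<in> C" "q \<in> C" "x \<in> snd p" "y \<in> snd q" using xy unfolding J_def by blast
        then show ?thesis using tot'[of p q] by blast
      qed
      have m: "is_subring (fst p)" "fst p \<subseteq> F" "is_ideal_in (fst p) (snd p)" "1 \<notin> snd p" "R \<subseteq> fst p" "I \<subseteq> snd p"
        "fst p \<subseteq> A" "snd p \<subseteq> J"
        if "p \<in> C" for p
      proof -
        have "p \<in> S" using that CS by blast
        then show "is_subring (fst p)" "fst p \<subseteq> F" "is_ideal_in (fst p) (snd p)" "1 \<notin> snd p" "R \<subseteq> fst p" "I \<subseteq> snd p"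
          unfolding S_def by auto
        show "fst p \<subseteq> A" "snd p \<subseteq> J" using that unfolding A_def J_def by auto
      qed
      obtain p0 where p0: "p0 \<in> C" using False by blast
      have RA: "R \<subseteq> A" "I \<subseteq> J" using m(5-8)[OF p0] by auto
      have "is_subring A"
        unfolding is_subring_def
      proof (intro conjI ballI)
        show "0 \<in> A" "1 \<in> A" using RA subringD[OF R(1)] by auto
        fix a b assume "a \<in> A" "b \<in> A"
        then obtain p where "p \<in> C" "a \<in> fst p" "b \<in> fst p" using up by blast
        then show "a + b \<in> A" "a - b \<in> A" "a * b \<in> A" using subringD(3-5)[OF m(1)] m(7) by (meson subset_iff)+
      qed
      moreover have "is_ideal_in A J"
        unfolding is_ideal_in_def
      proof (intro conjI ballI)
        show "J \<subseteq> A" using m(3) idealD(2) unfolding A_def J_def by fastforce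
        show "0 \<in> J" using RA idealD[OF I(1)] by blast
        { fix a b assume "a \<in> J" "b \<in> J"
          then obtain p where "p \<in> C" "a \<in> snd p" "b \<in> snd p" using upJJ by blast
          then show "a + b \<in> J" using idealD(3)[OF m(3)] m(8) by (meson subset_iff) }
        { fix a b assume "a \<in> A" "b \<in> J"
          then obtain p where "p \<in> C" "a \<in> fst p" "b \<in> snd p" using upJ by blast
          then show "a * b \<in> J" using idealD(4)[OF m(3)] m(8) by (meson subset_iff) }
      qed
      moreover have "A \<subseteq> F" "1 \<notin> J" using m(2,4) unfolding A_def J_def by blast+
      ultimately have "(A, J) \<in> S" using RA unfolding S_def by auto
      moreover have "\<forall>a\<in>C. le a (A, J)" unfolding le_def A_def J_def by auto
      ultimately show ?thesis by blast
    qed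
  qed
  then obtain A J where AJ: "(A, J) \<in> S" "\<And>a. a \<in> S \<Longrightarrow> le (A, J) a \<Longrightarrow> a = (A, J)" by auto
  show thesis
  proof (rule that[of A J])
    show "is_subring A" "A \<subseteq> F" "is_ideal_in A J" "1 \<notin> J" "R \<subseteq> A" "I \<subseteq> J"
      using AJ(1) unfolding S_def by auto
    fix A' J' assume "is_subring A'" "A' \<subseteq> F" "is_ideal_in A' J'" "1 \<notin> J'" "A \<subseteq> A'" "J \<subseteq> J'"
    then have "(A', J') \<in> S" "le (A, J) (A', J')" using AJ(1) unfolding S_def le_def by auto
    then show "A' = A \<and> J' = J" using AJ(2) by blast
  qed
qed

text \<open>Powers of \<open>1 - k\<close> stay congruent to 1 modulo \<open>J\<close>, so they
  never fall into a proper \<open>J\<close>. This is what makes \<open>1 - k\<close> a unit in a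
  maximal pair.\<close>

lemma ideal_one_minus_power:
  assumes "is_subring A" "is_ideal_in A J" "k \<in> J"
  shows "\<exists>j\<in>J. (1 - k) ^ n = 1 - j"
proof (induction n)
  case 0
  then show ?case using idealD[OF assms(2)] by (intro bexI[of _ 0]) auto
next
  case (Suc n)
  then obtain j where j: "j \<in> J" "(1 - k) ^ n = 1 - j" by blast
  have "(1 - k) ^ Suc n = 1 - (k + j - k * j)" unfolding power_Suc j(2) by (simp add: algebra_simps)
  moreover have "k + j - k * j \<in> J"
    using assms j idealD[OF assms(2)] by (intro ideal_diff[OF assms(1,2)]) auto
  ultimately show ?case by blast
qed

text \<open>Reduction of the degree: a relation for \<open>1/x\<close> of degree at most \<open>degree p\<close> eliminates the
  leading term of the relation \<open>poly p x = 1\<close>.\<close>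

lemma no_two_relations:
  assumes A: "is_subring A" and J: "is_ideal_in A J" "1 \<notin> J"
    and unit: "\<And>k. k \<in> J \<Longrightarrow> inverse (1 - k) \<in> A"
    and "x \<noteq> 0" "p \<in> polys_over J" "q \<in> polys_over J" "poly p x = 1" "poly q (inverse x) = 1"
  shows False
  using assms(5-)
proof (induction "degree p + degree q" arbitrary: p q x rule: less_induct)
  case less
  \<comment> \<open>Stated for arbitrary \<open>p\<close>, \<open>q\<close>, \<open>x\<close>, so
    that the case of \<open>q\<close> having the larger degree follows by exchanging the two
    relations and replacing \<open>x\<close> by its inverse.\<close>
  have red: False if le: "degree q \<le> degree p" and x: "x \<noteq> 0" and p: "p \<in> polys_over J" "q \<in> polys_over J"
    and e: "poly p x = 1" "poly q (inverse x) = 1"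
    and IH: "\<And>p'. degree p' < degree p \<Longrightarrow> p' \<in> polys_over J \<Longrightarrow> poly p' x = 1 \<Longrightarrow> False"
    for p q :: "'a poly" and x
  proof -
    define n where "n = degree p"
    define m where "m = degree q"
    define u where "u = inverse (1 - coeff q 0)"
    have cJ: "coeff p i \<in> J" "coeff q i \<in> J" for i using p unfolding polys_over_def by auto
    have u: "u \<in> A" "1 - coeff q 0 \<noteq> 0" using unit cJ(2)[of 0] J(2) unfolding u_def by auto
    have n: "n > 0"
    proof (rule ccontr)
      assume "\<not> n > 0"
      then have "poly p x = coeff p 0" unfolding n_def poly_altdef by simp
      then show False using e cJ J(2) by metis
    qed
    have "(\<Sum>i\<le>m. coeff q i * inverse x ^ i) = 1" using e unfolding poly_altdef m_def by simp
    moreover have "(\<Sum>i\<le>m. coeff q i * inverse x ^ i) = coeff q 0 + (\<Sum>i\<in>{1..m}. coeff q i * inverse x ^ i)"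
      by (simp add: atMost_atLeast0 sum.atLeast_Suc_atMost)
    ultimately have "(\<Sum>i\<in>{1..m}. coeff q i * inverse x ^ i) = 1 - coeff q 0" by (simp add: algebra_simps)
    then have s1: "u * (\<Sum>i\<in>{1..m}. coeff q i * inverse x ^ i) = 1" using u unfolding u_def by simp
    \<comment> \<open>Multiplying \<open>s1\<close> by \<open>coeff p n * x ^ n\<close> rewrites the
      leading term as a sum of terms in \<open>x ^ (n - i)\<close>. These are polynomial since
      \<open>i \<le> m \<le> n\<close>, and \<open>i \<ge> 1\<close> together with
      \<open>n > 0\<close> keeps them below degree \<open>n\<close>.\<close>
    define p' where "p' = p - monom (coeff p n) n + (\<Sum>i\<in>{1..m}. monom (coeff p n * u * coeff q i) (n - i))"
    have p'J: "p' \<in> polys_over J"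
    proof -
      have "coeff p' i \<in> J" for i
        unfolding p'_def coeff_add coeff_diff coeff_sum
        using cJ u idealD[OF J(1)]
        by (intro idealD(3)[OF J(1)] ideal_diff[OF A J(1)] ideal_sum[OF J(1)]) auto
      then show ?thesis unfolding polys_over_def by blast
    qed
    have d: "degree p' < n"
    proof (rule degree_lessI)
      show "p' \<noteq> 0 \<or> 0 < n" using n by simp
      show "\<forall>k\<ge>n. coeff p' k = 0"
      proof (intro allI impI)
        fix k assume k: "k \<ge> n"
        have "coeff (p - monom (coeff p n) n) k = 0" using k unfolding n_def by (auto simp: coeff_eq_0)
        moreover have "n - i \<noteq> k" if "i \<in> {1..m}" for i using that k n by auto
        ultimately show "coeff p' k = 0" unfolding p'_def by (simp add: coeff_sum)
      qed
    qed
    have "poly p' x = poly p x - coeff p n * x ^ n + (\<Sum>i\<in>{1..m}. coeff p n * u * coeff q i * x ^ (n - i))"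
      unfolding p'_def by (simp add: poly_sum poly_monom)
    also have "(\<Sum>i\<in>{1..m}. coeff p n * u * coeff q i * x ^ (n - i))
        = (\<Sum>i\<in>{1..m}. coeff p n * x ^ n * (u * (coeff q i * inverse x ^ i)))"
    proof (rule sum.cong[OF refl])
      fix i assume "i \<in> {1..m}"
      then have "x ^ n = x ^ (n - i) * x ^ i" using le unfolding n_def m_def by (simp flip: power_add)
      then show "coeff p n * u * coeff q i * x ^ (n - i) = coeff p n * x ^ n * (u * (coeff q i * inverse x ^ i))"
        using x by (simp add: power_inverse)
    qed
    also have "\<dots> = coeff p n * x ^ n * (u * (\<Sum>i\<in>{1..m}. coeff q i * inverse x ^ i))"
      by (simp add: sum_distrib_left)
    finally have "poly p' x = 1" using s1 e by simp
    then show False using IH[of p'] d p'J unfolding n_def by blast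
  qed
  show ?case
  proof (cases "degree q \<le> degree p")
    case True
    show ?thesis
    proof (rule red[OF True less.prems])
      fix p' assume "degree p' < degree p" "p' \<in> polys_over J" "poly p' x = 1"
      then show False using less.hyps[of p' q x] less.prems by simp
    qed
  next
    case False
    then have le: "degree p \<le> degree q" by simp
    have x: "inverse x \<noteq> 0" "poly p (inverse (inverse x)) = 1" using less.prems by auto
    show ?thesis
    proof (rule red[OF le x(1) less.prems(3,2,5) x(2)])
      fix q' assume "degree q' < degree q" "q' \<in> polys_over J" "poly q' (inverse x) = 1"
      then show False using less.hyps[of p q' x] less.prems by simp
    qed
  qed
qed

text \<open>Chevalley's extension theorem. The ring of a maximal pair is a valuation ring: if
  \<open>x\<close> and \<open>inverse x\<close> were both outside \<open>A\<close>, each would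
  satisfy a relation over \<open>J\<close>, which \<open>no_two_relations\<close> excludes.\<close>

lemma valuation_ring_exists:
  assumes F: "is_subfield F" and R: "is_subring R" "R \<subseteq> F" and I: "is_ideal_in R I" "1 \<notin> I"
  obtains V where "valuation_ring_of F V" "R \<subseteq> V" "I \<subseteq> nonunits V"
proof -
  obtain A J where A: "is_subring A" "A \<subseteq> F" and J: "is_ideal_in A J" "1 \<notin> J" and sub: "R \<subseteq> A" "I \<subseteq> J"
    and max: "\<And>A' J'. is_subring A' \<Longrightarrow> A' \<subseteq> F \<Longrightarrow> is_ideal_in A' J' \<Longrightarrow> 1 \<notin> J' \<Longrightarrow> A \<subseteq> A' \<Longrightarrow> J \<subseteq> J'
       \<Longrightarrow> A' = A \<and> J' = J"
    using maximal_pair_exists[OF R I] by metis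
  have rel: "\<exists>p\<in>polys_over J. poly p x = 1" if "x \<in> F" "x \<notin> A" for x
  proof (rule ccontr)
    assume "\<not> ?thesis"
    then have "\<And>p. p \<in> polys_over J \<Longrightarrow> poly p x \<noteq> 1" by blast
    note * = adjoin_pair[OF A(1) J(1) this]
    have "p \<in> polys_over F" if "p \<in> polys_over A" for p using that A(2) unfolding polys_over_def by blast
    then have "{poly p x |p. p \<in> polys_over A} \<subseteq> F"
      using poly_in_subring[OF subfieldD(1)[OF F] _ \<open>x \<in> F\<close>] by blast
    from max[OF *(1) this *(2-5)] have "x \<in> A" using *(6) by blast
    then show False using that by simp
  qed
  \<comment> \<open>If \<open>u = 1 - k\<close> had no inverse in \<open>A\<close>, a relation for
    \<open>inverse u\<close> multiplied by \<open>u ^ degree p\<close> would put this power of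
    \<open>u\<close> into \<open>J\<close>, although it is congruent to 1 modulo
    \<open>J\<close>.\<close>
  have unit: "inverse (1 - k) \<in> A" if k: "k \<in> J" for k
  proof (rule ccontr)
    assume na: "inverse (1 - k) \<notin> A"
    define u where "u = 1 - k"
    have uA: "u \<in> A" using k subringD(2,4)[OF A(1)] idealD(2)[OF J(1)] unfolding u_def by auto
    have u0: "u \<noteq> 0" using k J(2) unfolding u_def by auto
    have "inverse u \<in> F" "inverse u \<notin> A" using uA A(2) na subfieldD[OF F] unfolding u_def by auto
    then obtain p where p: "p \<in> polys_over J" "poly p (inverse u) = 1" using rel by blast
    have "u ^ degree p = u ^ degree p * poly p (inverse u)" using p by simp
    also have "\<dots> = (\<Sum>i\<le>degree p. coeff p i * u ^ (degree p - i))"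
      unfolding poly_altdef sum_distrib_left
    proof (rule sum.cong[OF refl])
      fix i assume "i \<in> {..degree p}"
      then have "u ^ degree p = u ^ (degree p - i) * u ^ i" by (simp flip: power_add)
      then show "u ^ degree p * (coeff p i * inverse u ^ i) = coeff p i * u ^ (degree p - i)"
        using u0 by (simp add: power_inverse)
    qed
    also have "\<dots> \<in> J"
      using p subring_power[OF A(1) uA] unfolding polys_over_def
      by (auto intro!: ideal_sum[OF J(1)] idealD(5)[OF J(1)])
    finally have 1: "u ^ degree p \<in> J" .
    obtain j where "j \<in> J" "u ^ degree p = 1 - j"
      using ideal_one_minus_power[OF A(1) J(1) k] unfolding u_def by blast
    then have "1 = u ^ degree p + j" by simp
    then show False using idealD(3)[OF J(1) 1 \<open>j \<in> J\<close>] J(2) by simp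
  qed
  have "valuation_ring_of F A"
    unfolding valuation_ring_of_def
  proof (intro conjI ballI impI A)
    fix x assume x: "x \<in> F" "x \<noteq> 0"
    show "x \<in> A \<or> inverse x \<in> A"
    proof (rule ccontr)
      assume no: "\<not> ?thesis"
      have "inverse x \<in> F" using x subfieldD[OF F] by blast
      then show False using rel[of x] rel[of "inverse x"] no x
          no_two_relations[OF A(1) J unit x(2)] by blast
    qed
  qed
  moreover have "J \<subseteq> nonunits A"
  proof
    fix x assume x: "x \<in> J"
    have "x = 0 \<or> inverse x \<notin> A"
    proof (rule ccontr)
      assume "\<not> ?thesis"
      then have "inverse x * x = 1" "inverse x \<in> A" by auto
      then show False using idealD(4)[OF J(1) _ x] J(2) by metis
    qed
    then show "x \<in> nonunits A" using x idealD[OF J(1)] unfolding nonunits_def by blast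
  qed
  ultimately show thesis using that sub by blast
qed

subsection \<open>Valuation rings and chains of primes\<close>

lemma valuation_ringD:
  assumes "valuation_ring_of F V"
  shows "is_subring V" "V \<subseteq> F" "\<And>x. x \<in> F \<Longrightarrow> x \<noteq> 0 \<Longrightarrow> x \<notin> V \<Longrightarrow> inverse x \<in> V"
  using assms unfolding valuation_ring_of_def by auto

lemma nonunitsD: "x \<in> nonunits V \<Longrightarrow> x \<in> V"
  by (simp add: nonunits_def)

lemma nonunits_mult_unit:
  assumes "is_subring V" "r \<in> V" "x \<in> nonunits V"
  shows "r * x \<in> nonunits V"
proof (cases "r * x = 0")
  case False
  have "inverse (r * x) \<notin> V"
  proof
    assume "inverse (r * x) \<in> V"
    then have "r * inverse (r * x) \<in> V" using assms subringD(5) by blast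
    moreover have "r * inverse (r * x) = inverse x" using False by (simp add: divide_simps)
    ultimately have "inverse x \<in> V" by metis
    then show False using assms(3) False by (simp add: nonunits_def)
  qed
  then show ?thesis using assms nonunitsD subringD(5) unfolding nonunits_def by blast
qed (use assms subringD in \<open>auto simp: nonunits_def\<close>)

text \<open>The valuation property enters only for sums: for nonzero \<open>a\<close>,
  \<open>b\<close> one of \<open>a / b\<close>, \<open>b / a\<close> lies in \<open>V\<close>, and
  \<open>a + b = (1 + a / b) * b\<close>.\<close>

lemma nonunits_ideal:
  assumes F: "is_subfield F" and V: "valuation_ring_of F V"
  shows "is_ideal_in V (nonunits V)"
  unfolding is_ideal_in_def
proof (intro conjI ballI)
  note VD = valuation_ringD[OF V] and D = subringD[OF valuation_ringD(1)[OF V]]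
  show "nonunits V \<subseteq> V" "0 \<in> nonunits V" using D by (auto simp: nonunits_def)
  show "r * x \<in> nonunits V" if "r \<in> V" "x \<in> nonunits V" for r x
    using nonunits_mult_unit[OF VD(1)] that by blast
  have aux: "a + b \<in> nonunits V" if ab: "a \<in> nonunits V" "b \<in> nonunits V" "b \<noteq> 0" "a / b \<in> V" for a b
  proof -
    have "(1 + a / b) * b \<in> nonunits V" using ab D by (intro nonunits_mult_unit[OF VD(1)]) auto
    moreover have "(1 + a / b) * b = a + b" using ab by (simp add: distrib_right)
    ultimately show ?thesis by simp
  qed
  fix a b assume ab: "a \<in> nonunits V" "b \<in> nonunits V"
  show "a + b \<in> nonunits V"
  proof (cases "a = 0 \<or> b = 0")
    case False
    then have "a / b \<in> F" "a / b \<noteq> 0"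
      using ab nonunitsD[of _ V] VD(2) subfieldD(3)[OF F, of a b] by (auto simp: subset_iff)
    then have "a / b \<in> V \<or> b / a \<in> V" using VD(3)[of "a / b"] by auto
    then show ?thesis using aux[of a b] aux[of b a] ab False by (auto simp: add.commute)
  qed (use ab in auto)
qed

lemma one_not_nonunit: "is_subring V \<Longrightarrow> 1 \<notin> nonunits V"
  using subringD by (auto simp: nonunits_def)

lemma nonunits_prime:
  assumes F: "is_subfield F" and V: "valuation_ring_of F V"
  shows "is_prime_in V (nonunits V)"
proof (rule primeI)
  note VD = valuation_ringD[OF V] and D = subringD[OF valuation_ringD(1)[OF V]]
  show "is_ideal_in V (nonunits V)" using nonunits_ideal[OF F V] .
  show "1 \<in> V" "1 \<notin> nonunits V" using D one_not_nonunit[OF VD(1)] by auto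
  fix a b assume "a \<in> V" "b \<in> V" "a * b \<in> nonunits V"
  then show "a \<in> nonunits V \<or> b \<in> nonunits V"
    using D(5)[of "inverse a" "inverse b"] unfolding nonunits_def by auto
qed

lemma prime_subset_nonunits:
  assumes V: "is_subring V" and Q: "is_prime_in V Q"
  shows "Q \<subseteq> nonunits V"
proof
  fix x assume x: "x \<in> Q"
  show "x \<in> nonunits V"
  proof (rule ccontr)
    assume "x \<notin> nonunits V"
    then have "inverse x \<in> V" "x \<noteq> 0" using x primeD(4)[OF Q] by (auto simp: nonunits_def)
    then have "inverse x * x \<in> Q" using idealD(4)[OF primeD(1)[OF Q]] x by blast
    then show False using \<open>x \<noteq> 0\<close> primeD(5)[OF Q] by simp
  qed
qed

text \<open>Localizing at \<open>P\<close> beforehand turns the elements of \<open>R - P\<close>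
  into units, so that the nonunits contract to \<open>P\<close> itself and not to a larger
  prime.\<close>

lemma valuation_ring_center:
  assumes F: "is_subfield F" and R: "is_subring R" "R \<subseteq> F" and P: "is_prime_in R P"
  obtains V where "valuation_ring_of F V" "R \<subseteq> V" "nonunits V \<inter> R = P"
proof -
  define T where "T = R - P"
  have T: "mult_set R T"
    using subringD(2,5)[OF R(1)] primeD(2,3,5)[OF P] unfolding mult_set_def T_def by auto
  have PT: "P \<inter> T = {}" unfolding T_def by blast
  note L = localization_ring[OF R(1) T]
  have LF: "localization R T \<subseteq> F"
    using R(2) subfieldD(3)[OF F] mult_setD(1)[OF T] unfolding localization_def by (auto simp: subset_iff)
  have id: "is_ideal_in (localization R T) (localization P T)"
    using localization_ideal[OF R(1) T primeD(1)[OF P]] .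
  have "1 \<notin> localization P T"
    using localization_prime_mem[OF R(1) T P PT, of 1] subringD[OF R(1)] primeD[OF P] by auto
  then obtain V where V: "valuation_ring_of F V" "localization R T \<subseteq> V" "localization P T \<subseteq> nonunits V"
    using valuation_ring_exists[OF F L(1) LF id] by blast
  have "nonunits V \<inter> R = P"
  proof
    show "P \<subseteq> nonunits V \<inter> R"
      using localization_prime_mem[OF R(1) T P PT] V(3) primeD(4)[OF P] by blast
    show "nonunits V \<inter> R \<subseteq> P"
    proof (rule ccontr)
      assume "\<not> nonunits V \<inter> R \<subseteq> P"
      then obtain x where x: "x \<in> nonunits V" "x \<in> T" unfolding T_def by blast
      then have "1 / x \<in> V" using V(2) localizationI[of 1 R x T] subringD[OF R(1)] by blast
      then show False using x mult_setD(2)[OF T] by (auto simp: nonunits_def inverse_eq_divide)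
    qed
  qed
  then show thesis using that[of V] V L(2) by blast
qed

text \<open>For \<open>x \<in> V'\<close> outside \<open>V\<close>, the element \<open>1/(s x)\<close> is a nonunit of \<open>V\<close>, so \<open>1/s = x \<cdot> 1/(s x)\<close> would lie in \<open>V'\<close>.\<close>

lemma refined_valuation_ring:
  assumes F: "is_subfield F" and V: "valuation_ring_of F V" and V': "valuation_ring_of F V'"
    and sub: "nonunits V \<subseteq> V'" and s: "s \<in> nonunits V'" "s \<noteq> 0" "inverse s \<in> V"
  shows "V' \<subseteq> V"
proof
  note VD = valuation_ringD[OF V] and VD' = valuation_ringD[OF V']
  fix x assume x: "x \<in> V'"
  show "x \<in> V"
  proof (rule ccontr)
    assume nx: "x \<notin> V"
    have "x \<noteq> 0" using nx subringD(1)[OF VD(1)] by auto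
    then have "inverse x \<in> V" using VD(3) VD'(2) x nx by blast
    then have "inverse x \<in> nonunits V" using nx \<open>x \<noteq> 0\<close> by (simp add: nonunits_def)
    then have "inverse s * inverse x \<in> V'" using nonunits_mult_unit[OF VD(1) s(3)] sub by blast
    then have "inverse s * inverse x * x \<in> V'" using x subringD(5)[OF VD'(1)] by blast
    moreover have "inverse s * inverse x * x = inverse s" using \<open>x \<noteq> 0\<close> by simp
    ultimately show False using s by (simp add: nonunits_def)
  qed
qed

text \<open>A prime of \<open>V\<close> consists of nonunits of \<open>V\<close>, hence already lies
  in \<open>V'\<close>, and contracting it changes nothing.\<close>

lemma prime_of_refined:
  assumes "is_subring V'" "V' \<subseteq> V" "nonunits V \<subseteq> V'" "is_subring V" "is_prime_in V Q"
  shows "is_prime_in V' Q"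
proof -
  have "Q \<subseteq> V'" using prime_subset_nonunits[OF assms(4,5)] assms(3) by blast
  then have "Q \<inter> V' = Q" by blast
  then show ?thesis using prime_contract[OF assms(1,4,2,5)] by simp
qed

text \<open>The smaller valuation ring keeps all primes of \<open>V\<close> and gains its own
  maximal ideal on top. The element \<open>s\<close>, a unit of \<open>V\<close> and a nonunit of
  \<open>V'\<close>, both forces \<open>V' \<subseteq> V\<close> and makes the last inclusion
  strict.\<close>

lemma prime_chain_extend_refined:
  assumes F: "is_subfield F" and V: "valuation_ring_of F V" and V': "valuation_ring_of F V'"
    and sub: "nonunits V \<subseteq> nonunits V'" and s: "s \<in> nonunits V'" "s \<noteq> 0" "inverse s \<in> V"
    and Q: "prime_chain V n Q"
  shows "prime_chain V' (Suc n) (Q(Suc n := nonunits V'))"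
proof -
  note VD = valuation_ringD[OF V] and VD' = valuation_ringD[OF V']
  have sub': "nonunits V \<subseteq> V'" using sub nonunitsD by blast
  have le: "V' \<subseteq> V" using refined_valuation_ring[OF F V V' sub' s] .
  have pr: "is_prime_in V' (Q i)" if "i \<le> n" for i
    using prime_of_refined[OF VD'(1) le sub' VD(1)] Q that unfolding prime_chain_def by blast
  have "Q n \<subseteq> nonunits V" using Q prime_subset_nonunits[OF VD(1)] unfolding prime_chain_def by blast
  moreover have "s \<notin> nonunits V" using s by (simp add: nonunits_def)
  ultimately have "Q n \<subset> nonunits V'" using sub s(1) by blast
  then show ?thesis
    using pr nonunits_prime[OF F V'] Q unfolding prime_chain_def by (auto simp: less_Suc_eq le_Suc_eq)
qed

section \<open>Rings of the form \<open>R + M\<close>, and lifting of chains\<close>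

text \<open>If \<open>M\<close> is the maximal ideal of a valuation ring \<open>V\<close>, this is
  the preimage of the image of \<open>R\<close> in the residue field. Valuation rings above it with
  \<open>M\<close> among their nonunits are the candidates for refining \<open>V\<close>.\<close>

lemma subring_plus_ideal:
  assumes "is_subring R" "is_subring V" "R \<subseteq> V" "is_ideal_in V M"
  shows "is_subring {r + m | r m. r \<in> R \<and> m \<in> M}" (is "is_subring ?T")
    and "R \<subseteq> {r + m | r m. r \<in> R \<and> m \<in> M}" "M \<subseteq> {r + m | r m. r \<in> R \<and> m \<in> M}"
    "{r + m | r m. r \<in> R \<and> m \<in> M} \<subseteq> V"
proof -
  note D = subringD[OF assms(1)] and E = subringD[OF assms(2)] and I = idealD[OF assms(4)]
  have TI: "r + m \<in> ?T" if "r \<in> R" "m \<in> M" for r m using that by blast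
  show a: "R \<subseteq> ?T" using I(1) TI[of _ 0] by auto
  show "M \<subseteq> ?T" using D(1) TI[of 0] by auto
  show "?T \<subseteq> V" using E(3) I(2) assms(3) by (auto simp: subset_iff)
  show "is_subring ?T"
    unfolding is_subring_def
  proof (intro conjI ballI)
    show "0 \<in> ?T" "1 \<in> ?T" using subsetD[OF a D(1)] subsetD[OF a D(2)] by simp_all
    fix x y assume "x \<in> ?T" "y \<in> ?T"
    then obtain r m t k where *: "x = r + m" "y = t + k" "r \<in> R" "m \<in> M" "t \<in> R" "k \<in> M" by blast
    have "x + y = (r + t) + (m + k)" "x - y = (r - t) + (m - k)"
      and xy: "x * y = r * t + (r * k + t * m + m * k)" using * by (simp_all add: algebra_simps)
    moreover have "(r + t) + (m + k) \<in> ?T" "(r - t) + (m - k) \<in> ?T"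
      using D(3,4) I(3) ideal_diff[OF assms(2,4)] * by (intro TI; blast)+
    ultimately show "x + y \<in> ?T" "x - y \<in> ?T" by simp_all
    have "r * k + t * m + m * k \<in> M" using * assms(3) I(2) by (intro I(3) I(4)) auto
    then show "x * y \<in> ?T" unfolding xy using TI D(5) * by blast
  qed
qed

lemma ideal_plus_ideal:
  assumes R: "is_subring R" "is_subring V" "R \<subseteq> V" and M: "is_ideal_in V M" and I: "is_ideal_in R P"
  shows "is_ideal_in {r + m | r m. r \<in> R \<and> m \<in> M} {r + m | r m. r \<in> P \<and> m \<in> M}" (is "is_ideal_in ?T ?Q")
  unfolding is_ideal_in_def
proof (intro conjI ballI)
  note PD = idealD[OF I] and I = idealD[OF M]
  have QI: "r + m \<in> ?Q" if "r \<in> P" "m \<in> M" for r m using that by blast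
  show "?Q \<subseteq> ?T" using PD(2) by blast
  show "0 \<in> ?Q" using QI[of 0 0] PD I by simp
  show "x + y \<in> ?Q" if xy: "x \<in> ?Q" "y \<in> ?Q" for x y
  proof -
    obtain r m t k where *: "x = r + m" "y = t + k" "r \<in> P" "m \<in> M" "t \<in> P" "k \<in> M" using xy by blast
    then have xy: "x + y = (r + t) + (m + k)" by simp
    show ?thesis unfolding xy using * PD(3) I(3) by (intro QI)
  qed
  show "x * y \<in> ?Q" if xy: "x \<in> ?T" "y \<in> ?Q" for x y
  proof -
    obtain r m t k where *: "x = r + m" "y = t + k" "r \<in> R" "m \<in> M" "t \<in> P" "k \<in> M" using xy by blast
    then have xy: "x * y = r * t + (r * k + t * m + m * k)" by (simp add: algebra_simps)
    have "r * k + t * m + m * k \<in> M" using * R(3) I(2) PD(2) by (intro I(3) I(4)) auto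
    then show ?thesis unfolding xy using * PD(4) by (intro QI)
  qed
qed

text \<open>Modulo \<open>M\<close> a product in \<open>R + M\<close> is the product
  \<open>r * t\<close> of the parts in \<open>R\<close>. The hypothesis
  \<open>M \<inter> R \<subseteq> P\<close> ensures that \<open>P + M\<close> contracts to
  \<open>P\<close>, so primality can be tested on these parts.\<close>

lemma prime_plus_ideal:
  assumes R: "is_subring R" "is_subring V" "R \<subseteq> V" and M: "is_ideal_in V M" and P: "is_prime_in R P" "M \<inter> R \<subseteq> P"
  shows "is_prime_in {r + m | r m. r \<in> R \<and> m \<in> M} {r + m | r m. r \<in> P \<and> m \<in> M}" (is "is_prime_in ?T ?Q")
    and "{r + m | r m. r \<in> P \<and> m \<in> M} \<inter> R = P" "M \<subseteq> {r + m | r m. r \<in> P \<and> m \<in> M}"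
proof -
  note D = subringD[OF R(1)] and E = subringD[OF R(2)] and I = idealD[OF M] and PD = idealD[OF primeD(1)[OF P(1)]]
  note T = subring_plus_ideal[OF R M]
  have QI: "r + m \<in> ?Q" if "r \<in> P" "m \<in> M" for r m using that by blast
  show eq: "?Q \<inter> R = P"
  proof
    show "P \<subseteq> ?Q \<inter> R" using QI[of _ 0] I(1) PD(2) by auto
    show "?Q \<inter> R \<subseteq> P"
    proof
      fix x assume "x \<in> ?Q \<inter> R"
      then obtain r m where *: "x = r + m" "r \<in> P" "m \<in> M" "x \<in> R" by blast
      then have "m = x - r" by simp
      then have "m \<in> R" using D(4) * PD(2) by blast
      then have "m \<in> P" using P(2) * by blast
      then show "x \<in> P" using * PD(3) by blast
    qed
  qed
  show "M \<subseteq> ?Q" using QI[of 0] PD(1) by auto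
  show "is_prime_in ?T ?Q"
  proof (rule primeI)
    show "1 \<in> ?T" using subringD(2)[OF T(1)] .
    show "1 \<notin> ?Q" using eq D(2) primeD(5)[OF P(1)] by blast
    show "is_ideal_in ?T ?Q" using ideal_plus_ideal[OF R M primeD(1)[OF P(1)]] .
    fix x y assume "x \<in> ?T" "y \<in> ?T" and xy: "x * y \<in> ?Q"
    then obtain r m t k where *: "x = r + m" "y = t + k" "r \<in> R" "m \<in> M" "t \<in> R" "k \<in> M" by blast
    obtain p n where pn: "x * y = p + n" "p \<in> P" "n \<in> M" using xy by blast
    have rt: "r * t = p + (n - (r * k + t * m + m * k))" using pn(1) * by (simp add: algebra_simps)
    have "r * k + t * m + m * k \<in> M" using * R(3) I(2) by (intro I(3) I(4)) auto
    then have "r * t \<in> ?Q" unfolding rt using pn ideal_diff[OF R(2) M] by (intro QI)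
    then have "r * t \<in> P" using eq D(5) * by blast
    then have "r \<in> P \<or> t \<in> P" using primeD(2)[OF P(1)] * by blast
    then show "x \<in> ?Q \<or> y \<in> ?Q" using * QI by blast
  qed
qed

text \<open>Each step replaces \<open>V\<close> by a valuation ring centered at
  \<open>P (Suc n) + M\<close> in \<open>R + M\<close>, with \<open>M\<close> the maximal ideal of
  \<open>V\<close>. The clause about \<open>nonunits V \<inter> R\<close> drives the induction: an
  element of \<open>P (Suc n)\<close> outside \<open>P n\<close> is a unit of \<open>V\<close> that
  turns into a nonunit.\<close>

lemma prime_chain_lift:
  assumes F: "is_subfield F" and R: "is_subring R" "R \<subseteq> F" and P: "prime_chain R n P"
  shows "\<exists>V Q. valuation_ring_of F V \<and> R \<subseteq> V \<and> prime_chain V n Q \<and> nonunits V \<inter> R = P n"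
  using P
proof (induction n)
  case 0
  then have "is_prime_in R (P 0)" unfolding prime_chain_def by simp
  then obtain V where "valuation_ring_of F V" "R \<subseteq> V" "nonunits V \<inter> R = P 0"
    using valuation_ring_center[OF F R] by blast
  moreover from this have "prime_chain V 0 (\<lambda>_. nonunits V)"
    using nonunits_prime[OF F] unfolding prime_chain_def by simp
  ultimately show ?case by blast
next
  case (Suc n)
  then have "prime_chain R n P" unfolding prime_chain_def by simp
  then obtain V Q where V: "valuation_ring_of F V" "R \<subseteq> V" and Q: "prime_chain V n Q"
    and c: "nonunits V \<inter> R = P n" using Suc.IH by blast
  note VD = valuation_ringD[OF V(1)]
  have M: "is_ideal_in V (nonunits V)" using nonunits_ideal[OF F V(1)] .
  have P: "is_prime_in R (P (Suc n))" "P n \<subset> P (Suc n)" using Suc.prems unfolding prime_chain_def by auto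
  obtain s where s: "s \<in> P (Suc n)" "s \<notin> P n" using P by blast
  have sR: "s \<in> R" using s primeD(4)[OF P(1)] by blast
  have su: "s \<noteq> 0" "inverse s \<in> V" using s sR c V(2) by (auto simp: nonunits_def)
  define T where "T = {r + m | r m. r \<in> R \<and> m \<in> nonunits V}"
  define I where "I = {r + m | r m. r \<in> P (Suc n) \<and> m \<in> nonunits V}"
  note T = subring_plus_ideal[OF R(1) VD(1) V(2) M, folded T_def]
  have "nonunits V \<inter> R \<subseteq> P (Suc n)" using c P by blast
  note I = prime_plus_ideal[OF R(1) VD(1) V(2) M P(1) this, folded T_def I_def]
  have "T \<subseteq> F" using T(4) VD(2) by blast
  then obtain V' where V': "valuation_ring_of F V'" "T \<subseteq> V'" "nonunits V' \<inter> T = I"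
    using valuation_ring_center[OF F T(1) _ I(1)] by blast
  have c': "nonunits V' \<inter> R = P (Suc n)" using V'(3) I(2) T(2) by blast
  have "nonunits V \<subseteq> nonunits V'" using I(3) V'(3) by blast
  moreover have "s \<in> nonunits V'" using c' s by blast
  ultimately have "prime_chain V' (Suc n) (Q(Suc n := nonunits V'))"
    using prime_chain_extend_refined[OF F V(1) V'(1) _ _ su Q] by blast
  then show ?case using V' T(2) c' by blast
qed

section \<open>Dimensions in terms of chains\<close>

definition has_chain :: "'f::field set \<Rightarrow> nat \<Rightarrow> bool" where
  "has_chain R n \<longleftrightarrow> (\<exists>P. prime_chain R n P)"

text \<open>Merges the two nested suprema of \<open>valuative_dim\<close> into one existence
  statement that stays usable when the dimension is infinite.\<close>

definition has_vchain :: "'f::field set \<Rightarrow> nat \<Rightarrow> bool" where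
  "has_vchain R n \<longleftrightarrow> (\<exists>V. valuation_ring_of (quot_field R) V \<and> R \<subseteq> V \<and> has_chain V n)"

lemma quot_field_subfield:
  assumes R: "is_subring R"
  shows "is_subfield (quot_field R)" "R \<subseteq> quot_field R"
proof -
  have eq: "quot_field R = localization R (R - {0})"
    unfolding quot_field_def localization_def by blast
  have T: "mult_set R (R - {0})" using subringD[OF R] unfolding mult_set_def by auto
  note L = localization_ring[OF R T]
  show "R \<subseteq> quot_field R" using L eq by simp
  have "inverse x \<in> quot_field R" if x: "x \<in> quot_field R" for x
  proof -
    obtain a b where *: "x = a / b" "a \<in> R" "b \<in> R" "b \<noteq> 0" using x unfolding quot_field_def by blast
    show ?thesis
    proof (cases "a = 0")
      case True
      then show ?thesis using * L(2) eq subringD[OF R] by auto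
    next
      case False
      then have "inverse x = b / a" using * by simp
      then show ?thesis unfolding quot_field_def using * False by blast
    qed
  qed
  then show "is_subfield (quot_field R)" using L eq unfolding is_subfield_def by simp
qed

lemma quot_field_overring:
  assumes "is_subring R" "R \<subseteq> V" "V \<subseteq> quot_field R"
  shows "quot_field V = quot_field R"
proof
  note F = subfieldD(3)[OF quot_field_subfield(1)[OF assms(1)]]
  show "quot_field R \<subseteq> quot_field V" using assms(2) unfolding quot_field_def by blast
  show "quot_field V \<subseteq> quot_field R"
  proof
    fix x assume "x \<in> quot_field V"
    then obtain a b where "x = a / b" "a \<in> V" "b \<in> V" unfolding quot_field_def by blast
    then show "x \<in> quot_field R" using F assms(3) by blast
  qed
qed

text \<open>An overring of \<open>R\<close> has the same quotient field as \<open>R\<close>, so the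
  valuation condition relative to its own quotient field becomes one relative to the fixed field
  \<open>quot_field R\<close>.\<close>

lemma valuation_overring_iff:
  assumes "is_subring R"
  shows "is_overring R V \<and> is_valuation_domain V \<longleftrightarrow> valuation_ring_of (quot_field R) V \<and> R \<subseteq> V"
  using quot_field_overring[OF assms, of V]
  unfolding is_overring_def is_valuation_domain_def valuation_ring_of_def by auto

lemma has_chain_0: "is_subring R \<Longrightarrow> has_chain R 0"
  using prime_zero unfolding has_chain_def prime_chain_def by fastforce

lemma has_chain_mono: "has_chain R n \<Longrightarrow> m \<le> n \<Longrightarrow> has_chain R m"
  unfolding has_chain_def prime_chain_def by (meson le_trans less_le_trans)

lemma has_chain_imp_has_vchain:
  assumes "is_subring R" "has_chain R n"
  shows "has_vchain R n"
  using prime_chain_lift[OF quot_field_subfield(1)[OF assms(1)] assms(1) quot_field_subfield(2)[OF assms(1)]] assms(2)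
  unfolding has_vchain_def has_chain_def by blast

text \<open>No value lies strictly between \<open>n - 1\<close> and \<open>n\<close>, so if all
  members were below \<open>n\<close>, their supremum would be at most \<open>n - 1\<close>.
  Nonemptiness serves \<open>n = 0\<close>, as the empty set has supremum 0.\<close>

lemma le_Sup_enat_iff:
  fixes A :: "enat set"
  assumes "enat n \<le> Sup A" "A \<noteq> {}"
  shows "\<exists>a\<in>A. enat n \<le> a"
proof (rule ccontr)
  assume "\<not> ?thesis"
  then have *: "a < enat n" if "a \<in> A" for a using that by force
  have "n > 0" using * assms(2) by (metis all_not_in_conv enat_0 gr0I not_less_zero)
  have "a \<le> enat (n - 1)" if "a \<in> A" for a
    using *[OF that] \<open>n > 0\<close> by (cases a) auto
  then have "Sup A \<le> enat (n - 1)" by (rule Sup_least)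
  then have "enat n \<le> enat (n - 1)" using assms(1) by (rule order_trans[rotated])
  then show False using \<open>n > 0\<close> by simp
qed

lemma le_krull_dim_iff:
  assumes "is_subring R"
  shows "enat n \<le> krull_dim R \<longleftrightarrow> has_chain R n"
proof -
  have eq: "krull_dim R = Sup {enat n | n. has_chain R n}"
    unfolding krull_dim_def has_chain_def prime_chain_def by simp
  show ?thesis
  proof
    assume "has_chain R n"
    then show "enat n \<le> krull_dim R" unfolding eq by (intro Sup_upper) blast
  next
    assume "enat n \<le> krull_dim R"
    then obtain m where "has_chain R m" "n \<le> m"
      using le_Sup_enat_iff[of n "{enat n | n. has_chain R n}"] has_chain_0[OF assms] unfolding eq by fastforce
    then show "has_chain R n" using has_chain_mono by blast
  qed
qed

lemma le_valuative_dim_iff: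
  assumes R: "is_subring R"
  shows "enat n \<le> valuative_dim R \<longleftrightarrow> has_vchain R n"
proof -
  define A where "A = {krull_dim V | V. valuation_ring_of (quot_field R) V \<and> R \<subseteq> V}"
  have eq: "valuative_dim R = Sup A"
    unfolding valuative_dim_def A_def valuation_overring_iff[OF R] ..
  have "valuation_ring_of (quot_field R) (quot_field R)"
    using quot_field_subfield[OF R] subfieldD(1) unfolding valuation_ring_of_def by blast
  then have ne: "A \<noteq> {}" using quot_field_subfield[OF R] unfolding A_def by blast
  show ?thesis
  proof
    assume "has_vchain R n"
    then obtain V where V: "valuation_ring_of (quot_field R) V" "R \<subseteq> V" "has_chain V n"
      unfolding has_vchain_def by blast
    then have "enat n \<le> krull_dim V" using le_krull_dim_iff[OF valuation_ringD(1)] by blast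
    also have "\<dots> \<le> valuative_dim R" unfolding eq A_def using V by (intro Sup_upper) blast
    finally show "enat n \<le> valuative_dim R" .
  next
    assume "enat n \<le> valuative_dim R"
    then obtain a where "a \<in> A" "enat n \<le> a" using le_Sup_enat_iff[OF _ ne] unfolding eq by blast
    then obtain V where V: "valuation_ring_of (quot_field R) V" "R \<subseteq> V" "enat n \<le> krull_dim V"
      unfolding A_def by blast
    then show "has_vchain R n" using le_krull_dim_iff[OF valuation_ringD(1)] unfolding has_vchain_def by blast
  qed
qed

subsection \<open>Polynomial rings and their localizations\<close>

lemma to_fract_power [simp]: "to_fract (x ^ n) = to_fract x ^ n"
  by (induction n) auto

lemma inj_to_fract: "inj_on to_fract A"
  by (simp add: inj_on_def)

lemma to_fract_sum: "to_fract (sum f S) = (\<Sum>i\<in>S. to_fract (f i))"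
  by (induction S rule: infinite_finite_induct) auto

lemma to_fract_image_iff [simp]: "to_fract p \<in> to_fract ` I \<longleftrightarrow> p \<in> I"
  by auto

lemma poly_ring_eq: "poly_ring R = to_fract ` polys_over R"
  unfolding poly_ring_def to_fract_def by blast

lemma poly_loc_eq: "poly_loc R S = localization (poly_ring R) (to_fract ` S)"
  unfolding poly_loc_def localization_def poly_ring_eq Fract_conv_to_fract by blast

lemma poly_ring_subring:
  assumes "is_subring R"
  shows "is_subring (poly_ring R)"
  unfolding is_subring_def poly_ring_eq
proof (intro conjI ballI)
  note P = polys_over_ring[OF assms]
  show "0 \<in> to_fract ` polys_over R" "1 \<in> to_fract ` polys_over R"
    using P(1,2) by (auto simp flip: to_fract_0 to_fract_1)
  fix x y :: "'a poly fract" assume "x \<in> to_fract ` polys_over R" "y \<in> to_fract ` polys_over R"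
  then show "x + y \<in> to_fract ` polys_over R" "x - y \<in> to_fract ` polys_over R"
    "x * y \<in> to_fract ` polys_over R"
    using P(3-5) by (auto simp flip: to_fract_add to_fract_diff to_fract_mult)
qed

lemma poly_ideal_to_fract:
  assumes "I \<subseteq> polys_over R" "0 \<in> I" "\<And>p q. p \<in> I \<Longrightarrow> q \<in> I \<Longrightarrow> p + q \<in> I"
    "\<And>p q. p \<in> polys_over R \<Longrightarrow> q \<in> I \<Longrightarrow> p * q \<in> I"
  shows "is_ideal_in (poly_ring R) (to_fract ` I)"
  unfolding is_ideal_in_def poly_ring_eq
proof (intro conjI ballI)
  show "to_fract ` I \<subseteq> to_fract ` polys_over R" "0 \<in> to_fract ` I"
    using assms(1,2) by (auto simp flip: to_fract_0)
  show "x + y \<in> to_fract ` I" if "x \<in> to_fract ` I" "y \<in> to_fract ` I" for x y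
    using that assms(3) by (auto simp flip: to_fract_add)
  show "x * y \<in> to_fract ` I" if "x \<in> to_fract ` polys_over R" "y \<in> to_fract ` I" for x y
    using that assms(4) by (auto simp flip: to_fract_mult)
qed

lemma poly_prime_to_fract:
  assumes R: "is_subring R" and I: "I \<subseteq> polys_over R" "0 \<in> I" "\<And>p q. p \<in> I \<Longrightarrow> q \<in> I \<Longrightarrow> p + q \<in> I"
    "\<And>p q. p \<in> polys_over R \<Longrightarrow> q \<in> I \<Longrightarrow> p * q \<in> I"
    and "1 \<notin> I" "\<And>p q. p \<in> polys_over R \<Longrightarrow> q \<in> polys_over R \<Longrightarrow> p * q \<in> I \<Longrightarrow> p \<in> I \<or> q \<in> I"
  shows "is_prime_in (poly_ring R) (to_fract ` I)"
proof (rule primeI)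
  show "is_ideal_in (poly_ring R) (to_fract ` I)" by (rule poly_ideal_to_fract[OF I])
  show "1 \<in> poly_ring R" using subringD(2)[OF poly_ring_subring[OF R]] .
  show "1 \<notin> to_fract ` I" using assms(6) by (simp flip: to_fract_1)
  fix x y assume "x \<in> poly_ring R" "y \<in> poly_ring R" and xy: "x * y \<in> to_fract ` I"
  then obtain p q where pq: "x = to_fract p" "y = to_fract q" "p \<in> polys_over R" "q \<in> polys_over R"
    unfolding poly_ring_eq by blast
  then have "p * q \<in> I" using xy by (simp flip: to_fract_mult)
  then show "x \<in> to_fract ` I \<or> y \<in> to_fract ` I" using assms(7) pq by blast
qed

text \<open>Gauss's argument with the least indices \<open>i\<close>, \<open>j\<close> whose
  coefficients lie outside \<open>P\<close>: in the coefficient of the product at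
  \<open>i + j\<close>, every other summand has a factor in \<open>P\<close>.\<close>

lemma polys_over_prime:
  assumes R: "is_subring R" and P: "is_prime_in R P" and pq: "p \<in> polys_over R" "q \<in> polys_over R" "p * q \<in> polys_over P"
  shows "p \<in> polys_over P \<or> q \<in> polys_over P"
proof (rule ccontr)
  assume "\<not> ?thesis"
  then have "\<exists>i. coeff p i \<notin> P" "\<exists>j. coeff q j \<notin> P" unfolding polys_over_def by auto
  then obtain i j where i: "coeff p i \<notin> P" "\<And>k. k < i \<Longrightarrow> coeff p k \<in> P"
    and j: "coeff q j \<notin> P" "\<And>k. k < j \<Longrightarrow> coeff q k \<in> P"
    using exists_least_iff[of "\<lambda>i. coeff p i \<notin> P"] exists_least_iff[of "\<lambda>i. coeff q i \<notin> P"] by auto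
  have c: "coeff p k \<in> R" "coeff q k \<in> R" for k using pq unfolding polys_over_def by auto
  note ID = idealD[OF primeD(1)[OF P]]
  have "coeff (p * q) (i + j) = (\<Sum>k\<in>{..i + j}. coeff p k * coeff q (i + j - k))"
    by (simp add: coeff_mult)
  also have "\<dots> = coeff p i * coeff q j + (\<Sum>k\<in>{..i + j} - {i}. coeff p k * coeff q (i + j - k))"
    by (subst sum.remove[of _ i]) auto
  finally have e: "coeff p i * coeff q j
      = coeff (p * q) (i + j) - (\<Sum>k\<in>{..i + j} - {i}. coeff p k * coeff q (i + j - k))"
    by simp
  have "(\<Sum>k\<in>{..i + j} - {i}. coeff p k * coeff q (i + j - k)) \<in> P"
  proof (rule ideal_sum[OF primeD(1)[OF P]])
    fix k assume k: "k \<in> {..i + j} - {i}"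
    show "coeff p k * coeff q (i + j - k) \<in> P"
    proof (cases "k < i")
      case True
      then show ?thesis using i(2) c ID(5) by blast
    next
      case False
      then have "i + j - k < j" using k by auto
      then show ?thesis using j(2) c ID(4) by blast
    qed
  qed
  moreover have "coeff (p * q) (i + j) \<in> P" using pq(3) unfolding polys_over_def by blast
  ultimately have "coeff p i * coeff q j \<in> P"
    unfolding e using ideal_diff[OF R primeD(1)[OF P]] by blast
  then show False using primeD(2)[OF P] c i j by blast
qed

lemma poly_ring_prime_extension:
  assumes R: "is_subring R" and P: "is_prime_in R P"
  shows "is_prime_in (poly_ring R) (to_fract ` polys_over P)"
proof (rule poly_prime_to_fract[OF R])
  note ID = primeD(1)[OF P]
  show "polys_over P \<subseteq> polys_over R" "0 \<in> polys_over P" "1 \<notin> polys_over P"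
    using primeD(3-5)[OF P] unfolding polys_over_def by (auto intro!: exI[of _ 0])
  show "p + q \<in> polys_over P" if "p \<in> polys_over P" "q \<in> polys_over P" for p q
    using polys_over_ideal_add[OF ID that] .
  show "p * q \<in> polys_over P" if "p \<in> polys_over R" "q \<in> polys_over P" for p q
    using ideal_polys_mult[OF R ID that] .
qed (use polys_over_prime[OF R P] in blast)

text \<open>The preimage of \<open>P\<close> under the constant-term map. It contains the extended
  prime \<open>P[X]\<close> properly, the difference being witnessed by \<open>X\<close>, and
  supplies the extra step of chains in a polynomial ring.\<close>

lemma poly_ring_prime_plus_X:
  assumes R: "is_subring R" and P: "is_prime_in R P"
  shows "is_prime_in (poly_ring R) (to_fract ` {f \<in> polys_over R. coeff f 0 \<in> P})"
proof (rule poly_prime_to_fract[OF R])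
  note ID = idealD[OF primeD(1)[OF P]]
  have c: "coeff p 0 \<in> R" if "p \<in> polys_over R" for p using that unfolding polys_over_def by blast
  show "p \<in> {f \<in> polys_over R. coeff f 0 \<in> P} \<or> q \<in> {f \<in> polys_over R. coeff f 0 \<in> P}"
    if "p \<in> polys_over R" "q \<in> polys_over R" "p * q \<in> {f \<in> polys_over R. coeff f 0 \<in> P}" for p q
    using that primeD(2)[OF P c c] by (auto simp: coeff_mult)
qed (use polys_over_ring[OF R] primeD(3-5)[OF P] idealD[OF primeD(1)[OF P]] in
      \<open>auto simp: coeff_mult polys_over_def\<close>)

lemma prime_chain_poly_ring:
  assumes R: "is_subring R" and P: "prime_chain R n P"
  shows "prime_chain (poly_ring R) n (\<lambda>i. to_fract ` polys_over (P i))"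
  unfolding prime_chain_def
proof (intro conjI allI impI)
  fix i assume "i \<le> n"
  then show "is_prime_in (poly_ring R) (to_fract ` polys_over (P i))"
    using P poly_ring_prime_extension[OF R] unfolding prime_chain_def by blast
next
  fix i assume i: "i < n"
  then have s: "P i \<subset> P (Suc i)" and pr: "is_prime_in R (P (Suc i))"
    using P unfolding prime_chain_def by auto
  then obtain x where x: "x \<in> P (Suc i)" "x \<notin> P i" by blast
  have "[:x:] \<in> polys_over (P (Suc i))"
    using x primeD(3)[OF pr] by (auto simp: polys_over_def coeff_pCons split: nat.split)
  moreover have "[:x:] \<notin> polys_over (P i)"
    using x by (auto simp: polys_over_def intro!: exI[of _ 0])
  moreover have "polys_over (P i) \<subseteq> polys_over (P (Suc i))" using s unfolding polys_over_def by blast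
  ultimately have "polys_over (P i) \<subset> polys_over (P (Suc i))" by blast
  then show "to_fract ` polys_over (P i) \<subset> to_fract ` polys_over (P (Suc i))"
    by (rule image_strict_mono[OF inj_to_fract])
qed

lemma prime_chain_poly_ring_Suc:
  assumes R: "is_subring R" and P: "prime_chain R n P"
  shows "prime_chain (poly_ring R) (Suc n)
    ((\<lambda>i. to_fract ` polys_over (P i))(Suc n := to_fract ` {f \<in> polys_over R. coeff f 0 \<in> P n}))"
proof -
  have pr: "is_prime_in R (P n)" using P unfolding prime_chain_def by blast
  have "monom 1 1 \<in> polys_over R" "monom 1 1 \<notin> polys_over (P n)"
    using polys_over_ring(6)[OF R subringD(2)[OF R]] primeD(5)[OF pr]
    by (auto simp: polys_over_def intro!: exI[of _ 1])
  then have "polys_over (P n) \<subset> {f \<in> polys_over R. coeff f 0 \<in> P n}"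
    using primeD(3,4)[OF pr] by (auto simp: polys_over_def psubset_eq set_eq_iff intro!: exI[of _ "monom 1 1"])
  then have "to_fract ` polys_over (P n) \<subset> to_fract ` {f \<in> polys_over R. coeff f 0 \<in> P n}"
    by (rule image_strict_mono[OF inj_to_fract])
  then show ?thesis
    using prime_chain_poly_ring[OF R P] poly_ring_prime_plus_X[OF R pr]
    unfolding prime_chain_def by (auto simp: less_Suc_eq le_Suc_eq)
qed

lemma mult_set_to_fract:
  assumes "S \<subseteq> polys_over R" "0 \<notin> S" "1 \<in> S" "\<And>p q. p \<in> S \<Longrightarrow> q \<in> S \<Longrightarrow> p * q \<in> S"
  shows "mult_set (poly_ring R) (to_fract ` S)"
  unfolding mult_set_def poly_ring_eq
proof (intro conjI ballI)
  show "to_fract ` S \<subseteq> to_fract ` polys_over R" "0 \<notin> to_fract ` S" "1 \<in> to_fract ` S"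
    using assms(1-3) by (auto simp flip: to_fract_0 to_fract_1)
  show "a * b \<in> to_fract ` S" if "a \<in> to_fract ` S" "b \<in> to_fract ` S" for a b
    using that assms(4) by (auto simp flip: to_fract_mult)
qed

lemma quot_field_localization:
  assumes R: "is_subring R" and T: "mult_set R T"
  shows "quot_field (localization R T) = quot_field R"
proof (rule quot_field_overring[OF R])
  show "R \<subseteq> localization R T" using localization_ring[OF R T] by blast
  show "localization R T \<subseteq> quot_field R"
    using mult_setD[OF T] unfolding localization_def quot_field_def by blast
qed

text \<open>With \<open>K\<close> the quotient field of \<open>R\<close>, these inclusions place
  \<open>K[X]\<close>, and hence \<open>V[X]\<close> for each valuation overring \<open>V\<close>,
  inside the quotient field of \<open>R[X]\<close>. That field plays the role of
  \<open>K(X)\<close>; it may be smaller than the ambient type.\<close>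

lemma quot_field_poly_ring:
  assumes R: "is_subring R"
  shows "\<And>a. a \<in> quot_field R \<Longrightarrow> to_fract [:a:] \<in> quot_field (poly_ring R)"
    and "poly_ring (quot_field R) \<subseteq> quot_field (poly_ring R)"
proof -
  define L where "L = quot_field (poly_ring R)"
  note L = quot_field_subfield[OF poly_ring_subring[OF R], folded L_def]
  have const: "to_fract [:a:] \<in> L" if a: "a \<in> quot_field R" for a
  proof -
    obtain x y where *: "a = x / y" "x \<in> R" "y \<in> R" "y \<noteq> 0" using a unfolding quot_field_def by blast
    have "[:a:] * [:y:] = [:x:]" using * by simp
    then have "to_fract [:a:] * to_fract [:y:] = to_fract [:x:]" by (metis to_fract_mult)
    then have "to_fract [:a:] = to_fract [:x:] / to_fract [:y:]" using *(4) by (simp add: eq_divide_eq)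
    moreover have "to_fract [:x:] \<in> poly_ring R" "to_fract [:y:] \<in> poly_ring R"
      using * polys_over_ring(7)[OF R] unfolding poly_ring_eq by auto
    ultimately show ?thesis using L(2) subfieldD(3)[OF L(1)] by auto
  qed
  show "to_fract [:a:] \<in> quot_field (poly_ring R)" if "a \<in> quot_field R" for a
    using const[OF that] unfolding L_def .
  show "poly_ring (quot_field R) \<subseteq> quot_field (poly_ring R)"
  proof
    fix x assume "x \<in> poly_ring (quot_field R)"
    then obtain p where p: "x = to_fract p" "p \<in> polys_over (quot_field R)" unfolding poly_ring_eq by blast
    have "to_fract (monom 1 i) \<in> L" for i
      using L(2) polys_over_ring(6)[OF R subringD(2)[OF R]] unfolding poly_ring_eq by blast
    then have "to_fract [:coeff p i:] * to_fract (monom 1 i) \<in> L" for i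
      using const p(2) subringD(5)[OF subfieldD(1)[OF L(1)]] unfolding polys_over_def by blast
    then have "(\<Sum>i\<le>degree p. to_fract [:coeff p i:] * to_fract (monom 1 i)) \<in> L"
      by (intro subring_sum[OF subfieldD(1)[OF L(1)]])
    also have "(\<Sum>i\<le>degree p. to_fract [:coeff p i:] * to_fract (monom 1 i)) = to_fract p"
      unfolding to_fract_mult[symmetric] to_fract_sum[symmetric]
      by (simp add: smult_monom poly_as_sum_of_monoms)
    finally show "x \<in> quot_field (poly_ring R)" unfolding L_def p(1) .
  qed
qed

subsection \<open>Valuation rings of the rational function field\<close>

text \<open>Gaussian elimination by cross-multiplication instead of division, so that the
  coefficients of the relation stay in \<open>R\<close>.\<close>

lemma polys_linear_dependence:
  assumes R: "is_subring R" and "finite J" "\<And>j. j \<in> J \<Longrightarrow> f j \<in> polys_over R"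
    "\<And>j i. j \<in> J \<Longrightarrow> i \<ge> n \<Longrightarrow> coeff (f j) i = 0" "card J > n"
  shows "\<exists>c. (\<forall>j\<in>J. c j \<in> R) \<and> (\<exists>j\<in>J. c j \<noteq> 0) \<and> (\<Sum>j\<in>J. smult (c j) (f j)) = 0"
  using assms(2-)
proof (induction n arbitrary: J f)
  case 0
  then have "f j = 0" if "j \<in> J" for j using that by (simp add: poly_eq_iff)
  moreover obtain j where "j \<in> J" using 0 by fastforce
  ultimately show ?case using subringD(2)[OF R] by (intro exI[of _ "\<lambda>_. 1"]) auto
next
  case (Suc n)
  show ?case
  proof (cases "\<forall>j\<in>J. coeff (f j) n = 0")
    case True
    have "coeff (f j) i = 0" if "j \<in> J" "i \<ge> n" for j i
      using that True Suc.prems(3)[of j i] by (cases "i = n") auto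
    then show ?thesis using Suc.IH[OF Suc.prems(1,2)] Suc.prems(4) by simp
  next
    case False
    then obtain j0 where j0: "j0 \<in> J" "coeff (f j0) n \<noteq> 0" by blast
    define e where "e j = coeff (f j) n" for j
    define g where "g j = smult (e j0) (f j) - smult (e j) (f j0)" for j
    have eR: "e j \<in> R" if "j \<in> J" for j using Suc.prems(2) that unfolding e_def polys_over_def by blast
    have "\<exists>c. (\<forall>j\<in>J - {j0}. c j \<in> R) \<and> (\<exists>j\<in>J - {j0}. c j \<noteq> 0) \<and> (\<Sum>j\<in>J - {j0}. smult (c j) (g j)) = 0"
    proof (rule Suc.IH)
      show "finite (J - {j0})" "card (J - {j0}) > n" using Suc.prems j0 by auto
      fix j assume j: "j \<in> J - {j0}"
      show "g j \<in> polys_over R"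
        using j j0(1) eR Suc.prems(2) subringD(4,5)[OF R] unfolding g_def polys_over_def by auto
      fix i assume i: "i \<ge> n"
      show "coeff (g j) i = 0"
        using i Suc.prems(3)[of j i] Suc.prems(3)[of j0 i] j j0 unfolding g_def e_def
        by (cases "i = n") auto
    qed
    then obtain c where c: "\<forall>j\<in>J - {j0}. c j \<in> R" "\<exists>j\<in>J - {j0}. c j \<noteq> 0" "(\<Sum>j\<in>J - {j0}. smult (c j) (g j)) = 0"
      by blast
    \<comment> \<open>Undoes the elimination: expanding each \<open>g j\<close> collects all
      multiples of \<open>f j0\<close> into one coefficient, which \<open>d j0\<close>
      compensates.\<close>
    define d where "d j = (if j = j0 then - (\<Sum>k\<in>J - {j0}. c k * e k) else e j0 * c j)" for j
    have "(\<Sum>j\<in>J. smult (d j) (f j)) = smult (d j0) (f j0) + (\<Sum>j\<in>J - {j0}. smult (d j) (f j))"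
      using j0 Suc.prems(1) by (simp add: sum.remove)
    also have "(\<Sum>j\<in>J - {j0}. smult (d j) (f j)) = (\<Sum>j\<in>J - {j0}. smult (c j) (g j) + smult (c j * e j) (f j0))"
      by (intro sum.cong) (auto simp: d_def g_def smult_diff_right mult.commute)
    also have "\<dots> = smult (\<Sum>k\<in>J - {j0}. c k * e k) (f j0)"
      by (simp add: sum.distrib c(3) smult_sum)
    finally have "(\<Sum>j\<in>J. smult (d j) (f j)) = 0" by (simp add: d_def)
    moreover have "\<exists>j\<in>J. d j \<noteq> 0" using c(2) j0 unfolding d_def e_def by auto
    moreover have "(\<Sum>k\<in>J - {j0}. c k * e k) \<in> R"
      using c(1) eR subringD(5)[OF R] by (intro subring_sum[OF R]) auto
    then have "\<forall>j\<in>J. d j \<in> R"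
      using c(1) eR[OF j0(1)] subringD(5,6)[OF R] unfolding d_def by auto
    ultimately show ?thesis by blast
  qed
qed

text \<open>A counting argument: the number of monomials in \<open>a\<close>, \<open>b\<close> grows
  quadratically with the exponent bound \<open>N\<close>, the degree after clearing denominators
  only linearly.\<close>

lemma algebraic_dependence:
  assumes R: "is_subring R" and a: "a \<in> quot_field (poly_ring R)" and b: "b \<in> quot_field (poly_ring R)"
  shows "\<exists>J c. finite J \<and> (\<forall>j\<in>J. c j \<in> R) \<and> (\<exists>j\<in>J. c j \<noteq> 0)
    \<and> (\<Sum>(k, l)\<in>J. to_fract [:c (k, l):] * (a ^ k * b ^ l)) = 0"
proof -
  obtain p q where a: "a = to_fract p / to_fract q" "p \<in> polys_over R" "q \<in> polys_over R" "q \<noteq> 0"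
    using a unfolding quot_field_def poly_ring_eq by auto
  obtain r s where b: "b = to_fract r / to_fract s" "r \<in> polys_over R" "s \<in> polys_over R" "s \<noteq> 0"
    using b unfolding quot_field_def poly_ring_eq by auto
  define d where "d = degree p + degree q + degree r + degree s"
  \<comment> \<open>With this choice the \<open>(N + 1)^2 = 4 * d^2 + 8 * d + 4\<close> monomials
    outnumber the \<open>2 * N * d + 1 = 4 * d^2 + 2 * d + 1\<close> coefficients that can be
    nonzero.\<close>
  define N where "N = 2 * d + 1"
  define J where "J = {..N} \<times> {..N}"
  \<comment> \<open>The polynomial \<open>a ^ k * b ^ l\<close> cleared by the common denominator
    \<open>q ^ N * s ^ N\<close>.\<close>
  define f where "f = (\<lambda>(k, l). (p ^ k * q ^ (N - k)) * (r ^ l * s ^ (N - l)))"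
  have fin: "finite J" unfolding J_def by simp
  have dg: "degree (f j) \<le> 2 * N * d" if jJ: "j \<in> J" for j
  proof -
    obtain k l where j: "j = (k, l)" "k \<le> N" "l \<le> N" using jJ unfolding J_def by blast
    have pw: "degree (u ^ k) \<le> k * d" if "degree u \<le> d" for u :: "'a poly" and k
      using order_trans[OF degree_power_le[of u k] mult_le_mono1[OF that, of k]] by (simp add: mult.commute)
    have "degree (f j) \<le> (degree (p ^ k) + degree (q ^ (N - k))) + (degree (r ^ l) + degree (s ^ (N - l)))"
      unfolding f_def j using degree_mult_le[of "p ^ k" "q ^ (N - k)"] degree_mult_le[of "r ^ l" "s ^ (N - l)"]
        degree_mult_le[of "p ^ k * q ^ (N - k)" "r ^ l * s ^ (N - l)"] by simp
    also have "\<dots> \<le> (k * d + (N - k) * d) + (l * d + (N - l) * d)"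
      by (intro add_mono pw) (auto simp: d_def)
    also have "\<dots> = 2 * N * d" using j by (simp flip: add_mult_distrib)
    finally show ?thesis .
  qed
  have "\<exists>c. (\<forall>j\<in>J. c j \<in> R) \<and> (\<exists>j\<in>J. c j \<noteq> 0) \<and> (\<Sum>j\<in>J. smult (c j) (f j)) = 0"
  proof (rule polys_linear_dependence[OF R fin, of f "Suc (2 * N * d)"])
    have "x ^ k \<in> polys_over R" if "x \<in> polys_over R" for x k
      using that polys_over_ring(2,5)[OF R] by (induction k) auto
    then show "f j \<in> polys_over R" if "j \<in> J" for j
      unfolding f_def using a(2,3) b(2,3) by (auto intro!: polys_over_ring(5)[OF R] split: prod.split)
    show "coeff (f j) i = 0" if "j \<in> J" "Suc (2 * N * d) \<le> i" for j i
      using dg[OF that(1)] that(2) by (intro coeff_eq_0) auto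
    show "Suc (2 * N * d) < card J"
      unfolding J_def N_def by (simp add: algebra_simps)
  qed
  then obtain c where c: "\<forall>j\<in>J. c j \<in> R" "\<exists>j\<in>J. c j \<noteq> 0" "(\<Sum>j\<in>J. smult (c j) (f j)) = 0" by blast
  define h where "h = to_fract q ^ N * to_fract s ^ N"
  have h0: "h \<noteq> 0" unfolding h_def using a b by simp
  have "to_fract (f j) = h * (a ^ fst j * b ^ snd j)" if jJ: "j \<in> J" for j
  proof -
    obtain k l where j: "j = (k, l)" "k \<le> N" "l \<le> N" using jJ unfolding J_def by blast
    have pw: "to_fract (u ^ k * v ^ (N - k)) = to_fract v ^ N * (to_fract u / to_fract v) ^ k"
      if "k \<le> N" "v \<noteq> 0" for u v :: "'a poly" and k
    proof -
      have "to_fract v ^ N = to_fract v ^ (N - k) * to_fract v ^ k" using that by (simp flip: power_add)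
      then show ?thesis using that by (simp add: power_divide)
    qed
    show ?thesis unfolding j f_def h_def prod.case to_fract_mult[of "p ^ k * q ^ (N - k)"]
      using pw[of k q p] pw[of l s r] a b j by (simp add: mult_ac)
  qed
  moreover have "to_fract (smult (c j) (f j)) = to_fract [:c j:] * to_fract (f j)" for j
    by (simp flip: to_fract_mult)
  ultimately have "to_fract (\<Sum>j\<in>J. smult (c j) (f j)) = h * (\<Sum>j\<in>J. to_fract [:c j:] * (a ^ fst j * b ^ snd j))"
    unfolding to_fract_sum sum_distrib_left
    by (intro sum.cong) (auto simp: mult_ac)
  then have "(\<Sum>j\<in>J. to_fract [:c j:] * (a ^ fst j * b ^ snd j)) = 0" using c(3) h0 by simp
  then show ?thesis using fin c by (intro exI[of _ J] exI[of _ c]) (simp add: case_prod_beta)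
qed

text \<open>The ultrametric principle: in a vanishing sum the minimal value occurs twice. Otherwise
  division by a term \<open>t j\<close> of minimal value would express -1 as a sum of
  nonunits.\<close>

lemma two_terms_of_equal_value:
  assumes F: "is_subfield F" and W: "valuation_ring_of F W" and J: "finite J"
    and t: "\<And>j. j \<in> J \<Longrightarrow> t j \<in> F" "\<exists>j\<in>J. t j \<noteq> 0" "(\<Sum>j\<in>J. t j) = 0"
  shows "\<exists>i\<in>J. \<exists>j\<in>J. i \<noteq> j \<and> t i \<noteq> 0 \<and> t j \<noteq> 0 \<and> t i / t j \<in> W \<and> t j / t i \<in> W"
proof -
  note WD = valuation_ringD[OF W]
  \<comment> \<open>A nonzero term of minimal value exists in every finite subfamily that is not
    identically zero.\<close>
  have "\<exists>j\<in>I. t j \<noteq> 0 \<and> (\<forall>i\<in>I. t i / t j \<in> W)" if "I \<subseteq> J" "\<exists>j\<in>I. t j \<noteq> 0" for I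
    using finite_subset[OF that(1) J] that
  proof (induction I rule: finite_induct)
    case (insert x I)
    show ?case
    proof (cases "\<exists>j\<in>I. t j \<noteq> 0")
      case False
      then have "t x \<noteq> 0" "t i = 0" if "i \<in> I" for i using insert that by auto
      then show ?thesis using insert False subringD(1,2)[OF WD(1)] by (intro bexI[of _ x]) auto
    next
      case True
      then obtain j where j: "j \<in> I" "t j \<noteq> 0" "\<forall>i\<in>I. t i / t j \<in> W" using insert by auto
      show ?thesis
      proof (cases "t x / t j \<in> W")
        case True
        then show ?thesis using j by (intro bexI[of _ j]) auto
      next
        case False
        have "t x / t j \<in> F" using t(1) insert j subfieldD(3)[OF F] by auto
        moreover have nz: "t x \<noteq> 0" using False subringD(1)[OF WD(1)] by auto
        ultimately have jx: "t j / t x \<in> W" using WD(3)[of "t x / t j"] j False by auto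
        have "t i / t x \<in> W" if "i \<in> I" for i
        proof -
          have "(t i / t j) * (t j / t x) \<in> W" using that j jx subringD(5)[OF WD(1)] by blast
          then show ?thesis using j by simp
        qed
        then have all: "\<forall>i\<in>insert x I. t i / t x \<in> W" using nz subringD(2)[OF WD(1)] by simp
        show ?thesis by (rule bexI[of _ x], rule conjI[OF nz all]) simp
      qed
    qed
  qed auto
  from this[OF subset_refl t(2)] obtain j where j: "j \<in> J" "t j \<noteq> 0" and all: "\<forall>i\<in>J. t i / t j \<in> W"
    by (elim bexE conjE)
  show ?thesis
  proof (rule ccontr)
    assume no: "\<not> ?thesis"
    have tj: "t i / t j \<in> W" if "i \<in> J" for i using all that by (rule bspec)
    have "t i / t j \<in> nonunits W" if i: "i \<in> J - {j}" for i
    proof (cases "t i = 0")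
      case True
      then show ?thesis using subringD(1)[OF WD(1)] by (simp add: nonunits_def)
    next
      case False
      have "t j / t i \<notin> W"
      proof
        assume "t j / t i \<in> W"
        then have "i \<noteq> j \<and> t i \<noteq> 0 \<and> t j \<noteq> 0 \<and> t i / t j \<in> W \<and> t j / t i \<in> W"
          using False i j(2) tj[of i] by simp
        then show False using no i j(1) by (meson DiffD1)
      qed
      then show ?thesis using tj[of i] i by (simp add: nonunits_def)
    qed
    then have *: "(\<Sum>i\<in>J - {j}. t i / t j) \<in> nonunits W"
      by (rule ideal_sum[OF nonunits_ideal[OF F W]])
    have "t j + (\<Sum>i\<in>J - {j}. t i) = 0" using t(3) j J by (simp add: sum.remove)
    then have "(\<Sum>i\<in>J - {j}. t i) = - t j" by (simp add: eq_neg_iff_add_eq_0 add.commute)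
    then have "(\<Sum>i\<in>J - {j}. t i / t j) = - 1" using j by (simp flip: sum_divide_distrib)
    then have "- (- 1) \<in> nonunits W" using * ideal_uminus[OF WD(1) nonunits_ideal[OF F W]] by metis
    then show False using one_not_nonunit[OF WD(1)] by simp
  qed
qed

text \<open>Rank at most one over the constants: generators \<open>a\<close>, \<open>b\<close> of the values in two collapsed
  steps are algebraically dependent, so two monomials \<open>a\<^sup>k b\<^sup>l\<close> differ in value by a constant.\<close>

lemma no_two_collapsed_steps:
  assumes R: "is_subring R" and W: "valuation_ring_of (quot_field (poly_ring R)) W"
    and P: "is_prime_in W P0" "is_prime_in W P1" "is_prime_in W Q0" "is_prime_in W Q1"
    and sub: "P0 \<subset> P1" "P1 \<subseteq> Q0" "Q0 \<subset> Q1"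
    and cP: "\<And>d. d \<in> quot_field R \<Longrightarrow> to_fract [:d:] \<in> P1 \<Longrightarrow> to_fract [:d:] \<in> P0"
    and cQ: "\<And>d. d \<in> quot_field R \<Longrightarrow> to_fract [:d:] \<in> Q1 \<Longrightarrow> to_fract [:d:] \<in> Q0"
  shows False
proof -
  define L where "L = quot_field (poly_ring R)"
  have L: "is_subfield L" "poly_ring R \<subseteq> L"
    using quot_field_subfield[OF poly_ring_subring[OF R]] unfolding L_def by auto
  note W = W[folded L_def]
  note WD = valuation_ringD[OF W] and D = subringD[OF valuation_ringD(1)[OF W]]
  note K = quot_field_subfield[OF R]
  obtain a where a: "a \<in> P1" "a \<notin> P0" using sub by blast
  obtain b where b: "b \<in> Q1" "b \<notin> Q0" using sub by blast
  have aW: "a \<in> W" and bW: "b \<in> W" using a b primeD(4) P by blast+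
  have a0: "a \<noteq> 0" and b0: "b \<noteq> 0" using a b primeD(3) P by blast+
  have bp: "b ^ r \<in> W" "b ^ r \<notin> Q0" for r
    using subring_power[OF WD(1) bW] prime_power[OF WD(1) P(3) bW] b(2) by auto
  have ap: "a ^ r \<in> W" "a ^ r \<notin> P0" for r
    using subring_power[OF WD(1) aW] prime_power[OF WD(1) P(1) aW] a(2) by auto
  have aQ: "a \<in> Q0" using a sub by blast
  \<comment> \<open>Since \<open>a\<close> lies in \<open>Q0\<close> and no power of
    \<open>b\<close> does, every power of \<open>b\<close> divides \<open>a\<close> in
    \<open>W\<close>, and the quotient stays between \<open>P0\<close> and \<open>P1\<close>. The
    value of \<open>a\<close> is thus infinitely large compared with that of
    \<open>b\<close>.\<close>
  have ab: "a / b ^ r \<in> P1" "a / b ^ r \<notin> P0" for r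
  proof -
    have "a / b ^ r \<in> L" using aW bp WD(2) subfieldD(3)[OF L(1)] by blast
    have abW: "a / b ^ r \<in> W"
    proof (rule ccontr)
      assume "a / b ^ r \<notin> W"
      then have "b ^ r / a \<in> W" using WD(3)[OF \<open>a / b ^ r \<in> L\<close>] a0 b0 by auto
      then have "(b ^ r / a) * a \<in> Q0" using aQ idealD(4)[OF primeD(1)[OF P(3)]] by blast
      then show False using bp(2)[of r] a0 by simp
    qed
    have e: "a = (a / b ^ r) * b ^ r" using b0 by simp
    have "b ^ r \<notin> P1" using bp sub by blast
    then show "a / b ^ r \<in> P1" using primeD(2)[OF P(2) abW bp(1)] a(1) e by metis
    show "a / b ^ r \<notin> P0" using idealD(5)[OF primeD(1)[OF P(1)] _ bp(1)] a(2) e by metis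
  qed
  have unit_mult: "u * w \<in> I \<longleftrightarrow> w \<in> I"
    if I: "is_prime_in W I" and u: "u \<in> W" "inverse u \<in> W" "u \<noteq> 0" for I u w
  proof
    assume "u * w \<in> I"
    then have "inverse u * (u * w) \<in> I" using idealD(4)[OF primeD(1)[OF I]] u by blast
    moreover have "inverse u * (u * w) = w" using u(3) by simp
    ultimately show "w \<in> I" by simp
  qed (use idealD(4)[OF primeD(1)[OF I]] u in blast)
  \<comment> \<open>The exponent pairs are compared lexicographically. If the exponents of
    \<open>a\<close> differ, the quotient of the two monomials lies in \<open>P1\<close> but not in
    \<open>P0\<close>; if they agree, it lies in \<open>Q1\<close> but not in \<open>Q0\<close>. Up
    to a unit the quotient is a constant, which \<open>cP\<close> and \<open>cQ\<close>
    forbid.\<close>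
  have key: False if less: "k' < k \<or> k' = k \<and> l' < l" and d: "d \<in> quot_field R"
    and u: "u \<in> W" "inverse u \<in> W" "u \<noteq> 0"
    and eq: "to_fract [:d:] * (a ^ k' * b ^ l') = u * (a ^ k * b ^ l)" for k k' l l' d u
  proof -
    have cancel: "to_fract [:d:] = u * w" if "w * (a ^ k' * b ^ l') = a ^ k * b ^ l" for w
    proof -
      have "to_fract [:d:] * (a ^ k' * b ^ l') = (u * w) * (a ^ k' * b ^ l')" using eq that by (simp add: mult.assoc)
      then show ?thesis using a0 b0 by simp
    qed
    show False
    proof (cases "k' < k")
      case True
      \<comment> \<open>One factor \<open>a\<close> is set aside: it puts the quotient into
        \<open>P1\<close> and absorbs a possible negative power of \<open>b\<close>.\<close>
      define r where "r = k - k' - 1"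
      have k: "k = r + 1 + k'" using True unfolding r_def by simp
      have "\<exists>w. w \<in> P1 \<and> w \<notin> P0 \<and> w * (a ^ k' * b ^ l') = a ^ k * b ^ l"
      proof (cases "l' \<le> l")
        case True
        have "b ^ (l - l') \<notin> P0" using bp sub by blast
        then have "(a ^ r * b ^ (l - l')) * a \<notin> P0"
          using primeD(2)[OF P(1) ap(1) bp(1)] primeD(2)[OF P(1) D(5)[OF ap(1) bp(1)] aW] ap(2) a(2) by blast
        moreover have "(a ^ r * b ^ (l - l')) * a \<in> P1"
          using a(1) idealD(4)[OF primeD(1)[OF P(2)]] D(5)[OF ap(1) bp(1)] by blast
        moreover have "b ^ l = b ^ (l - l') * b ^ l'" using True by (simp flip: power_add)
        then have "(a ^ r * b ^ (l - l')) * a * (a ^ k' * b ^ l') = a ^ k * b ^ l"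
          unfolding k by (simp add: power_add mult_ac)
        ultimately show ?thesis by blast
      next
        case False
        have abW: "a / b ^ (l' - l) \<in> W" using ab(1) primeD(4)[OF P(2)] by blast
        have "a ^ r * (a / b ^ (l' - l)) \<notin> P0"
          using primeD(2)[OF P(1) ap(1) abW] ap(2) ab(2) by blast
        moreover have "a ^ r * (a / b ^ (l' - l)) \<in> P1"
          using ab(1) idealD(4)[OF primeD(1)[OF P(2)]] ap(1) by blast
        moreover have "b ^ l' = b ^ (l' - l) * b ^ l" using False by (simp flip: power_add)
        then have "a ^ r * (a / b ^ (l' - l)) * (a ^ k' * b ^ l') = a ^ k * b ^ l"
          unfolding k using b0 by (simp add: power_add mult_ac)
        ultimately show ?thesis by blast
      qed
      then obtain w where w: "w \<in> P1" "w \<notin> P0" "to_fract [:d:] = u * w" using cancel by blast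
      then show False using unit_mult[OF P(1) u] unit_mult[OF P(2) u] cP[OF d] by metis
    next
      case False
      then have kl: "k' = k" "l' < l" using less by auto
      have "b ^ l = b ^ (l - l') * b ^ l'" using kl by (simp flip: power_add)
      then have "b ^ (l - l') * (a ^ k' * b ^ l') = a ^ k * b ^ l" using kl by (simp add: mult_ac)
      then have e: "to_fract [:d:] = u * b ^ (l - l')" by (rule cancel)
      have "l - l' = Suc (l - l' - 1)" using kl by simp
      then have "b ^ (l - l') = b ^ (l - l' - 1) * b" by (metis power_Suc2)
      then have "b ^ (l - l') \<in> Q1" using idealD(4)[OF primeD(1)[OF P(4)] bp(1) b(1)] by metis
      then have "to_fract [:d:] \<in> Q0" using unit_mult[OF P(4) u] cQ[OF d] e by metis
      then show False using unit_mult[OF P(3) u] bp(2) e by metis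
    qed
  qed
  have "a \<in> quot_field (poly_ring R)" "b \<in> quot_field (poly_ring R)"
    using aW bW WD(2) unfolding L_def by auto
  from algebraic_dependence[OF R this]
  obtain J c where J: "finite J" "\<forall>j\<in>J. c j \<in> R" "\<exists>j\<in>J. c j \<noteq> 0"
    "(\<Sum>(k, l)\<in>J. to_fract [:c (k, l):] * (a ^ k * b ^ l)) = 0"
    by (elim exE conjE)
  define t where "t = (\<lambda>(k, l). to_fract [:c (k, l):] * (a ^ k * b ^ l))"
  have "t j \<in> L" if "j \<in> J" for j
  proof -
    obtain k l where j: "j = (k, l)" by (cases j)
    have "to_fract [:c j:] \<in> L"
      using J(2) that L(2) polys_over_ring(7)[OF R] unfolding poly_ring_eq by blast
    moreover have "a ^ k * b ^ l \<in> L" using D(5)[OF ap(1) bp(1)] WD(2) by blast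
    ultimately show ?thesis using subringD(5)[OF subfieldD(1)[OF L(1)]] unfolding t_def j by simp
  qed
  moreover have "t j \<noteq> 0" if "c j \<noteq> 0" for j using that a0 b0 unfolding t_def by (cases j) simp
  then have "\<exists>j\<in>J. t j \<noteq> 0" using J(3) by blast
  moreover have "(\<Sum>j\<in>J. t j) = 0" using J(4) unfolding t_def .
  ultimately obtain i j where ij: "i \<in> J" "j \<in> J" "i \<noteq> j" "t i \<noteq> 0" "t j \<noteq> 0" "t i / t j \<in> W" "t j / t i \<in> W"
    using two_terms_of_equal_value[OF L(1) W J(1)] by metis
  \<comment> \<open>Two terms of equal value have a unit \<open>t j / t i\<close> as quotient, and
    \<open>c j / c i\<close> is the constant that relates their monomials in
    \<open>key\<close>.\<close>
  have fin: False if ij: "i \<in> J" "j \<in> J" "t i \<noteq> 0" "t j \<noteq> 0" "t i / t j \<in> W" "t j / t i \<in> W"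
    and less: "fst j < fst i \<or> fst j = fst i \<and> snd j < snd i" for i j
  proof -
    obtain k l k' l' where kl: "i = (k, l)" "j = (k', l')" by (cases i, cases j)
    have c0: "c i \<noteq> 0" "c j \<noteq> 0" using ij(3,4) unfolding t_def kl by auto
    have "c j / c i \<in> quot_field R" using J(2) ij(1,2) K(2) subfieldD(3)[OF K(1)] by blast
    moreover have "inverse (t j / t i) \<in> W" "t j / t i \<noteq> 0" using ij by simp_all
    moreover have "to_fract [:c j / c i:] * (a ^ k' * b ^ l') = (t j / t i) * (a ^ k * b ^ l)"
    proof -
      have "[:c j / c i:] * [:c i:] = [:c j:]" using c0 by simp
      then have "to_fract [:c j / c i:] * to_fract [:c i:] = to_fract [:c j:]" by (metis to_fract_mult)
      moreover have "t j = to_fract [:c j:] * (a ^ k' * b ^ l')" "t i = to_fract [:c i:] * (a ^ k * b ^ l)"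
        unfolding t_def kl by simp_all
      ultimately have "to_fract [:c j / c i:] * (a ^ k' * b ^ l') * t i = t j * (a ^ k * b ^ l)"
        by (simp add: mult_ac)
      then show ?thesis using ij(3) by (simp add: field_simps)
    qed
    ultimately show False using key[of k' k l' l "c j / c i" "t j / t i"] less ij(6) unfolding kl by simp
  qed
  have "(fst j < fst i \<or> fst j = fst i \<and> snd j < snd i) \<or> (fst i < fst j \<or> fst i = fst j \<and> snd i < snd j)"
    using ij(3) by (auto simp: prod_eq_iff)
  then show False using fin[of i j] fin[of j i] ij by blast
qed

text \<open>If a step before the last one collapses, deleting it leaves a strict chain of length
  \<open>n\<close>. If none does, the first \<open>n\<close> steps are already strict, whatever
  happens at the last.\<close>

lemma has_chain_skip:
  assumes pr: "\<And>i. i \<le> Suc n \<Longrightarrow> is_prime_in V (f i)" and mono: "\<And>i. i \<le> n \<Longrightarrow> f i \<subseteq> f (Suc i)"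
    and one: "\<And>i j. i < j \<Longrightarrow> j \<le> n \<Longrightarrow> f i = f (Suc i) \<Longrightarrow> f j = f (Suc j) \<Longrightarrow> False"
  shows "has_chain V n"
proof (cases "\<exists>i<n. f i = f (Suc i)")
  case False
  then have "prime_chain V n f" using pr mono unfolding prime_chain_def by (auto simp: psubset_eq)
  then show ?thesis unfolding has_chain_def by blast
next
  case True
  then obtain m where m: "m < n" "f m = f (Suc m)" by blast
  define g where "g i = (if i \<le> m then f i else f (Suc i))" for i
  have "f i \<noteq> f (Suc i)" if "i \<le> n" "i \<noteq> m" for i
    using one[of i m] one[of m i] m that by (cases "i < m") auto
  then have "f i \<subset> f (Suc i)" if "i \<le> n" "i \<noteq> m" for i using that mono by blast
  then have "g i \<subset> g (Suc i)" if "i < n" for i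
    using that m unfolding g_def by (cases "i = m") (auto simp: less_Suc_eq)
  moreover have "is_prime_in V (g i)" if "i \<le> n" for i using that pr unfolding g_def by auto
  ultimately show ?thesis unfolding has_chain_def prime_chain_def by blast
qed

lemma to_fract_const_inverse: "to_fract [:inverse (a::'a::field):] = inverse (to_fract [:a:])"
proof (cases "a = 0")
  case False
  then have "[:inverse a:] * [:a:] = 1" by (simp add: one_pCons)
  then have "to_fract [:inverse a:] * to_fract [:a:] = 1" by (metis to_fract_mult to_fract_1)
  then show ?thesis using False by (simp add: field_simps)
qed simp

text \<open>The primes are contracted to the valuation ring of constants lying in \<open>W\<close>.
  Only constants of \<open>R\<close> are required in \<open>W\<close>, not \<open>X\<close>, so that
  the lemma also applies to valuation rings having \<open>1/X\<close> as a nonunit.\<close>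

lemma contraction_to_constants:
  assumes R: "is_subring R" and W: "valuation_ring_of (quot_field (poly_ring R)) W"
    and sub: "\<And>a. a \<in> R \<Longrightarrow> to_fract [:a:] \<in> W" and ch: "has_chain W (Suc n)"
  shows "has_vchain R n"
proof -
  note WD = valuation_ringD[OF W] and K = quot_field_subfield[OF R]
  define V where "V = {a \<in> quot_field R. to_fract [:a:] \<in> W}"
  note KD = subringD[OF subfieldD(1)[OF K(1)]]
  have hom: "to_fract [:a + b:] = to_fract [:a:] + to_fract [:b:]" "to_fract [:a - b:] = to_fract [:a:] - to_fract [:b:]"
    "to_fract [:a * b:] = to_fract [:a:] * to_fract [:b:]" "to_fract [:0:] = 0" "to_fract [:1:] = 1" for a b :: 'a
    by (simp_all flip: to_fract_add to_fract_diff to_fract_mult one_pCons)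
  have V: "is_subring V"
    unfolding is_subring_def V_def using KD subringD[OF WD(1)] by (auto simp: hom)
  have VK: "valuation_ring_of (quot_field R) V"
    unfolding valuation_ring_of_def
  proof (intro conjI ballI impI V)
    show "V \<subseteq> quot_field R" unfolding V_def by blast
    fix x assume x: "x \<in> quot_field R" "x \<noteq> 0"
    then have "to_fract [:x:] \<in> W \<or> inverse (to_fract [:x:]) \<in> W"
      using WD(3)[OF quot_field_poly_ring(1)[OF R]] by auto
    then show "x \<in> V \<or> inverse x \<in> V"
      using x subfieldD(2)[OF K(1)] unfolding V_def by (auto simp: to_fract_const_inverse)
  qed
  have RV: "R \<subseteq> V" using sub K(2) unfolding V_def by blast
  obtain Q where Q: "prime_chain W (Suc n) Q" using ch unfolding has_chain_def by blast
  have Qp: "is_prime_in W (Q i)" if "i \<le> Suc n" for i using Q that unfolding prime_chain_def by blast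
  have Qs: "Q i \<subset> Q (Suc i)" if "i \<le> n" for i using Q that unfolding prime_chain_def by auto
  define f where "f i = {a \<in> quot_field R. to_fract [:a:] \<in> Q i}" for i
  have "has_chain V n"
  proof (rule has_chain_skip[of n V f])
    fix i assume i: "i \<le> Suc n"
    note P = Qp[OF i]
    show "is_prime_in V (f i)"
    proof (rule primeI)
      show "1 \<in> V" using subringD(2)[OF V] .
      show "1 \<notin> f i" using primeD(5)[OF P] unfolding f_def by (simp add: hom)
      show "is_ideal_in V (f i)"
        unfolding is_ideal_in_def f_def V_def
        using KD idealD[OF primeD(1)[OF P]] by (auto simp: hom)
      fix a b assume "a \<in> V" "b \<in> V" "a * b \<in> f i"
      then show "a \<in> f i \<or> b \<in> f i"
        using primeD(2)[OF P, of "to_fract [:a:]" "to_fract [:b:]"] unfolding f_def V_def by (auto simp: hom)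
    qed
  next
    fix i assume "i \<le> n"
    then show "f i \<subseteq> f (Suc i)" using Qs unfolding f_def by blast
  next
    fix i j assume ij: "i < j" "j \<le> n" and eq: "f i = f (Suc i)" "f j = f (Suc j)"
    have "Suc i \<le> j" using ij by simp
    then have "Q (Suc i) \<subseteq> Q j"
      using ij(2)
    proof (induction j rule: dec_induct)
      case (step k)
      then show ?case using Qs[of k] by auto
    qed simp
    then show False
      using no_two_collapsed_steps[OF R W Qp[of i] Qp[of "Suc i"] Qp[of j] Qp[of "Suc j"] Qs[of i] _ Qs[of j]]
        ij eq unfolding f_def by auto
  qed
  then show ?thesis using VK RV unfolding has_vchain_def by blast
qed

section \<open>Valuation rings in which the monic polynomials are units\<close>

lemma U_setD:
  assumes "is_subring D"
  shows "g \<in> U_set D \<Longrightarrow> g \<in> polys_over D" "g \<in> U_set D \<Longrightarrow> g \<noteq> 0" "monom 1 k \<in> U_set D"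
  using polys_over_ring(6)[OF assms subringD(2)[OF assms]]
  by (auto simp: U_set_def degree_monom_eq)

lemma monic_monom_minus:
  fixes p :: "'a::field poly"
  assumes R: "is_subring R" and p: "p \<in> polys_over R" "degree p < k"
  shows "monom 1 k - p \<in> U_set R"
proof -
  have "coeff (monom 1 k - p) k = 1" using p(2) by (simp add: coeff_eq_0)
  moreover have "degree (monom 1 k - p) \<le> k" using p(2) by (intro degree_diff_le) (auto simp: degree_monom_le)
  ultimately have "degree (monom 1 k - p) = k" by (metis le_antisym le_degree one_neq_zero)
  then show ?thesis
    using \<open>coeff (monom 1 k - p) k = 1\<close> p(1) polys_over_ring(4,6)[OF R] subringD(2)[OF R]
    unfolding U_set_def by auto
qed

text \<open>If all monic polynomials are units of \<open>W\<close>, then \<open>1/X\<close> is a nonunit of \<open>D[1/X] + M\<close> with \<open>M\<close>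
  the maximal ideal of \<open>W\<close>, hence of some valuation ring properly refining \<open>W\<close>.\<close>

lemma has_chain_refine_monic_units:
  assumes R: "is_subring R" and W: "valuation_ring_of (quot_field (poly_ring R)) W"
    and sub: "poly_ring R \<subseteq> W" and units: "\<And>g. g \<in> U_set R \<Longrightarrow> inverse (to_fract g) \<in> W" and ch: "has_chain W n"
  shows "\<exists>W'. valuation_ring_of (quot_field (poly_ring R)) W' \<and> (\<forall>a\<in>R. to_fract [:a:] \<in> W') \<and> has_chain W' (Suc n)"
proof -
  define L where "L = quot_field (poly_ring R)"
  have L: "is_subfield L" "poly_ring R \<subseteq> L"
    using quot_field_subfield[OF poly_ring_subring[OF R]] unfolding L_def by auto
  note W = W[folded L_def]
  note WD = valuation_ringD[OF W] and D = subringD[OF valuation_ringD(1)[OF W]]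
  have M: "is_ideal_in W (nonunits W)" using nonunits_ideal[OF L(1) W] .
  note P = polys_over_ring[OF R]
  have one: "1 \<in> R" using subringD(2)[OF R] .
  define X :: "nat \<Rightarrow> 'a poly fract" where "X k = to_fract (monom 1 k)" for k
  have X0: "X k \<noteq> 0" for k unfolding X_def by simp
  have Xmult: "X k * X l = X (k + l)" for k l unfolding X_def by (simp add: mult_monom flip: to_fract_mult)
  have Xi: "inverse (X k) \<in> W" "X k \<in> W" for k
    using units[OF U_setD(3)[OF R]] sub P(6)[OF one] unfolding X_def poly_ring_eq by blast+
  \<comment> \<open>This is the ring \<open>R[1/X]\<close>: a polynomial of degree at most
    \<open>k\<close> divided by the power \<open>X^k\<close>. With strict inequality of degrees,
    \<open>E0\<close> is the ideal generated by \<open>1/X\<close>.\<close>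
  define E where "E = {to_fract p / X k | p k. p \<in> polys_over R \<and> degree p \<le> k}"
  define E0 where "E0 = {to_fract p / X k | p k. p \<in> polys_over R \<and> degree p < k}"
  have EI: "to_fract p / X k \<in> E" if "p \<in> polys_over R" "degree p \<le> k" for p k
    unfolding E_def using that by blast
  have E0I: "to_fract p / X k \<in> E0" if "p \<in> polys_over R" "degree p < k" for p k
    unfolding E0_def using that by blast
  have dm: "degree (monom 1 k :: 'a poly) = k" for k by (simp add: degree_monom_eq)
  have sums: "to_fract p / X k + to_fract q / X l = to_fract (p * monom 1 l + q * monom 1 k) / X (k + l)"
    "to_fract p / X k - to_fract q / X l = to_fract (p * monom 1 l - q * monom 1 k) / X (k + l)"
    "(to_fract p / X k) * (to_fract q / X l) = to_fract (p * q) / X (k + l)" for p q k l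
    unfolding Xmult[symmetric] using X0 by (simp_all add: X_def[symmetric] add_frac_eq diff_frac_eq)
  have dle: "degree (p * q) \<le> k + l" if "degree p \<le> k" "degree q \<le> l" for p q :: "'a poly" and k l
    using degree_mult_le[of p q] that by linarith
  have mon: "monom 1 k \<in> polys_over R" for k using P(6)[OF one] .
  have E: "is_subring E"
    unfolding is_subring_def
  proof (intro conjI ballI)
    show "0 \<in> E" using EI[of 0 0] P(1) by simp
    show "1 \<in> E" using EI[of 1 0] P(2) unfolding X_def by simp
    fix x y assume "x \<in> E" "y \<in> E"
    then obtain p k q l where *: "x = to_fract p / X k" "y = to_fract q / X l" "p \<in> polys_over R" "degree p \<le> k"
      "q \<in> polys_over R" "degree q \<le> l" unfolding E_def by blast
    have "degree (p * monom 1 l) \<le> k + l" "degree (q * monom 1 k) \<le> k + l" "degree (p * q) \<le> k + l"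
      using dle[of p k "monom 1 l" l] dle[of q l "monom 1 k" k] dle[of p k q l] *(4,6) dm by (simp_all add: add.commute)
    note d = this
    show "x + y \<in> E" unfolding *(1,2) sums using *(3,5) d(1,2)
      by (intro EI P(3)[OF P(5)[OF _ mon] P(5)[OF _ mon]] degree_add_le)
    show "x - y \<in> E" unfolding *(1,2) sums using *(3,5) d(1,2)
      by (intro EI P(4)[OF P(5)[OF _ mon] P(5)[OF _ mon]] degree_diff_le)
    show "x * y \<in> E" unfolding *(1,2) sums using *(3,5) d(3) by (intro EI P(5))
  qed
  have E0: "is_ideal_in E E0"
    unfolding is_ideal_in_def
  proof (intro conjI ballI)
    show "E0 \<subseteq> E" unfolding E_def E0_def using less_imp_le by blast
    show "0 \<in> E0" using E0I[of 0 1] P(1) by simp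
    show "x + y \<in> E0" if xy: "x \<in> E0" "y \<in> E0" for x y
    proof -
      obtain p k q l where *: "x = to_fract p / X k" "y = to_fract q / X l" "p \<in> polys_over R" "degree p < k"
        "q \<in> polys_over R" "degree q < l" using xy unfolding E0_def by blast
      have "degree (p * monom 1 l) < k + l" "degree (q * monom 1 k) < k + l"
        using degree_mult_le[of p "monom 1 l"] degree_mult_le[of q "monom 1 k"] *(4,6) dm[of k] dm[of l] by linarith+
      then show ?thesis unfolding *(1,2) sums using *(3,5)
        by (intro E0I P(3)[OF P(5)[OF _ mon] P(5)[OF _ mon]] degree_add_less)
    qed
    show "x * y \<in> E0" if xy: "x \<in> E" "y \<in> E0" for x y
    proof -
      obtain p k q l where *: "x = to_fract p / X k" "y = to_fract q / X l" "p \<in> polys_over R" "degree p \<le> k"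
        "q \<in> polys_over R" "degree q < l" using xy unfolding E0_def E_def by blast
      have "degree (p * q) < k + l" using degree_mult_le[of p q] *(4,6) by linarith
      then show ?thesis unfolding *(1,2) sums using *(3,5) by (intro E0I P(5))
    qed
  qed
  have EW: "E \<subseteq> W"
  proof
    fix x assume "x \<in> E"
    then obtain p k where "x = to_fract p * inverse (X k)" "to_fract p \<in> W"
      using sub unfolding E_def poly_ring_eq divide_inverse by blast
    then show "x \<in> W" using D(5) Xi(1) by blast
  qed
  define T where "T = {r + m | r m. r \<in> E \<and> m \<in> nonunits W}"
  define I where "I = {r + m | r m. r \<in> E0 \<and> m \<in> nonunits W}"
  note T = subring_plus_ideal[OF E WD(1) EW M, folded T_def]
  have I: "is_ideal_in T I" using ideal_plus_ideal[OF E WD(1) EW M E0] unfolding T_def I_def .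
  \<comment> \<open>If 1 were in \<open>I\<close>, some \<open>1 - p / X^k = (X^k - p) / X^k\<close>
    with \<open>degree p < k\<close> would be a nonunit of \<open>W\<close>; but its numerator is
    monic and \<open>X\<close> is a unit.\<close>
  have "1 \<notin> I"
  proof
    assume "1 \<in> I"
    then obtain p k m where *: "1 = to_fract p / X k + m" "p \<in> polys_over R" "degree p < k" "m \<in> nonunits W"
      unfolding I_def E0_def by blast
    define g where "g = monom 1 k - p"
    have g: "g \<in> U_set R" unfolding g_def using monic_monom_minus[OF R *(2,3)] .
    have "m = 1 - to_fract p / X k" using *(1) by (metis add_diff_cancel_left')
    also have "\<dots> = to_fract g / X k" unfolding g_def using X0[of k] by (simp add: X_def diff_divide_distrib)
    finally have m: "m = to_fract g / X k" .
    have "inverse m = inverse (to_fract g) * X k" unfolding m by (simp add: divide_inverse mult.commute)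
    then have "inverse m \<in> W" using units[OF g] Xi(2) D(5) by simp
    moreover have "m \<noteq> 0" unfolding m using X0 U_setD(2)[OF R g] by simp
    ultimately show False using *(4) by (simp add: nonunits_def)
  qed
  have "T \<subseteq> L" using T(4) WD(2) by blast
  then obtain W' where W': "valuation_ring_of L W'" "T \<subseteq> W'" "I \<subseteq> nonunits W'"
    using valuation_ring_exists[OF L(1) T(1) _ I \<open>1 \<notin> I\<close>] by blast
  have z: "0 \<in> E0" "0 \<in> nonunits W" using idealD(1) E0 M by blast+
  have MI: "nonunits W \<subseteq> nonunits W'"
  proof
    fix m assume "m \<in> nonunits W"
    then have "0 + m \<in> I" unfolding I_def using z by blast
    then show "m \<in> nonunits W'" using W'(3) by auto
  qed
  \<comment> \<open>The new step of the chain comes from \<open>1/X\<close>, a nonunit of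
    \<open>W'\<close> whose inverse \<open>X\<close> lies in \<open>W\<close>.\<close>
  have "to_fract 1 / X 1 \<in> E0" using E0I[of 1 1] P(2) by simp
  then have "to_fract 1 / X 1 + 0 \<in> I" unfolding I_def using z by blast
  then have s: "inverse (X 1) \<in> nonunits W'" using W'(3) by (auto simp: inverse_eq_divide)
  obtain Q where "prime_chain W n Q" using ch unfolding has_chain_def by blast
  then have "prime_chain W' (Suc n) (Q(Suc n := nonunits W'))"
    using prime_chain_extend_refined[OF L(1) W W'(1) MI s] X0 Xi(2) by simp
  moreover have "to_fract [:a:] \<in> W'" if "a \<in> R" for a
    using EI[of "[:a:]" 0] P(7)[OF that] T(2) W'(2) unfolding X_def by auto
  ultimately show ?thesis using W'(1) unfolding L_def has_chain_def by blast
qed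

subsection \<open>Reversal of polynomials\<close>

text \<open>For \<open>degree f \<le> n\<close> this is \<open>X^n f(1/X)\<close>. Reversal at a
  common \<open>n\<close> is additive, whereas \<open>reflect_poly\<close> is multiplicative but not
  additive; the ideal properties of reversed primes use both.\<close>

definition reverse_poly :: "nat \<Rightarrow> 'a::field poly \<Rightarrow> 'a poly" where
  "reverse_poly n f = monom 1 (n - degree f) * reflect_poly f"

lemma coeff_reverse_poly:
  assumes "degree f \<le> n"
  shows "coeff (reverse_poly n f) i = (if i \<le> n then coeff f (n - i) else 0)"
  using assms by (auto simp: reverse_poly_def coeff_monom_mult coeff_reflect_poly coeff_eq_0)

lemma degree_reverse_poly_le: "degree f \<le> n \<Longrightarrow> degree (reverse_poly n f) \<le> n"
  by (rule degree_le) (simp add: coeff_reverse_poly)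

lemma reverse_poly_add:
  "degree f \<le> n \<Longrightarrow> degree g \<le> n \<Longrightarrow> reverse_poly n (f + g) = reverse_poly n f + reverse_poly n g"
  by (auto simp: poly_eq_iff coeff_reverse_poly degree_add_le)

lemma reverse_poly_reverse_poly: "degree f \<le> n \<Longrightarrow> reverse_poly n (reverse_poly n f) = f"
  by (auto simp: poly_eq_iff coeff_reverse_poly degree_reverse_poly_le coeff_eq_0)

lemma reflect_poly_polys_over: "is_subring R \<Longrightarrow> f \<in> polys_over R \<Longrightarrow> reflect_poly f \<in> polys_over R"
  by (auto simp: polys_over_def coeff_reflect_poly intro: subringD)

lemma monom_not_in_prime:
  assumes "is_subring R" "Q \<inter> to_fract ` U_set R = {}"
  shows "to_fract (monom 1 k) \<notin> Q"
  using assms U_setD(3)[OF assms(1)] by blast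

text \<open>The substitution \<open>X \<mapsto> 1/X\<close> turns a chain of primes avoiding monic polynomials into a chain of
  primes none of which contains \<open>X\<close>, and whose top prime together with \<open>X\<close> generates a proper ideal.\<close>

lemma has_chain_Suc_of_monic_disjoint:
  assumes R: "is_subring R" and Q: "prime_chain (poly_ring R) n Q"
    and disj: "\<And>i. i \<le> n \<Longrightarrow> Q i \<inter> to_fract ` U_set R = {}"
  shows "has_chain (poly_ring R) (Suc n)"
proof -
  note P = polys_over_ring[OF R] and rp = reflect_poly_polys_over[OF R]
  \<comment> \<open>The image of \<open>Q i\<close> under the substitution of \<open>1/X\<close> for
    \<open>X\<close>, with denominators cleared.\<close>
  define I where "I i = {f \<in> polys_over R. to_fract (reflect_poly f) \<in> Q i}" for i
  have Qp: "is_prime_in (poly_ring R) (Q i)" if "i \<le> n" for i using Q that unfolding prime_chain_def by blast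
  have pr: "to_fract f \<in> poly_ring R \<longleftrightarrow> f \<in> polys_over R" for f unfolding poly_ring_eq by simp
  have mon: "monom 1 k \<in> polys_over R" for k using P(6)[OF subringD(2)[OF R]] .
  \<comment> \<open>The two reversals differ by a power of \<open>X\<close>, a monic polynomial
    outside the prime \<open>Q i\<close>, so membership does not depend on the length
    \<open>m\<close>.\<close>
  have rv: "to_fract (reverse_poly m f) \<in> Q i \<longleftrightarrow> to_fract (reflect_poly f) \<in> Q i"
    if "i \<le> n" "f \<in> polys_over R" for i m f
    using primeD(2)[OF Qp[OF that(1)], of "to_fract (monom 1 (m - degree f))" "to_fract (reflect_poly f)"]
      idealD(4)[OF primeD(1)[OF Qp[OF that(1)]], of "to_fract (monom 1 (m - degree f))" "to_fract (reflect_poly f)"]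
      monom_not_in_prime[OF R disj[OF that(1)], of "m - degree f"] rp[OF that(2)] mon[of "m - degree f"]
    unfolding reverse_poly_def to_fract_mult pr by blast
  have Iprime: "is_prime_in (poly_ring R) (to_fract ` I i)" if i: "i \<le> n" for i
  proof (rule poly_prime_to_fract[OF R])
    note q = primeD[OF Qp[OF i]] and qi = idealD[OF primeD(1)[OF Qp[OF i]]]
    show "I i \<subseteq> polys_over R" unfolding I_def by blast
    show "0 \<in> I i" using q(3) P(1) unfolding I_def by simp
    show "1 \<notin> I i" using q(5) unfolding I_def by simp
    show "p + q \<in> I i" if pq: "p \<in> I i" "q \<in> I i" for p q
    proof -
      define m where "m = max (degree p) (degree q)"
      have p: "p \<in> polys_over R" "q \<in> polys_over R" using pq unfolding I_def by auto
      have "to_fract (reverse_poly m p) \<in> Q i" "to_fract (reverse_poly m q) \<in> Q i"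
        using pq rv[OF i p(1)] rv[OF i p(2)] unfolding I_def by auto
      then have "to_fract (reverse_poly m (p + q)) \<in> Q i"
        using qi(3) by (simp add: reverse_poly_add m_def)
      then show ?thesis using rv[OF i P(3)[OF p]] P(3)[OF p] unfolding I_def by simp
    qed
    show "p * q \<in> I i" if "p \<in> polys_over R" "q \<in> I i" for p q
      using that qi(4)[of "to_fract (reflect_poly p)" "to_fract (reflect_poly q)"] rp P(5)
      unfolding I_def pr by (simp add: reflect_poly_mult)
    show "p \<in> I i \<or> q \<in> I i" if "p \<in> polys_over R" "q \<in> polys_over R" "p * q \<in> I i" for p q
      using that q(2)[of "to_fract (reflect_poly p)" "to_fract (reflect_poly q)"] rp
      unfolding I_def pr by (simp add: reflect_poly_mult)
  qed
  have Istrict: "I i \<subset> I (Suc i)" if i: "i < n" for i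
  proof -
    have s: "Q i \<subset> Q (Suc i)" using Q i unfolding prime_chain_def by blast
    then obtain x where x: "x \<in> Q (Suc i)" "x \<notin> Q i" by blast
    then obtain f where f: "x = to_fract f" "f \<in> polys_over R"
      using primeD(4)[OF Qp[of "Suc i"]] i unfolding poly_ring_eq by auto
    \<comment> \<open>If \<open>f\<close> is divisible by \<open>X\<close>, reflecting twice loses
      that power of \<open>X\<close>. Reversing \<open>g\<close> at length \<open>degree f\<close>
      recovers \<open>f\<close> exactly.\<close>
    define g where "g = reflect_poly f"
    have g: "g = reverse_poly (degree f) f" unfolding g_def reverse_poly_def by (simp flip: one_pCons)
    have gR: "g \<in> polys_over R" unfolding g_def using rp[OF f(2)] .
    have "reverse_poly (degree f) g = f" unfolding g by (simp add: reverse_poly_reverse_poly)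
    then have "g \<in> I (Suc i)" "g \<notin> I i"
      using rv[OF _ gR, of "Suc i" "degree f"] rv[OF _ gR, of i "degree f"] x f gR i unfolding I_def by auto
    moreover have "I i \<subseteq> I (Suc i)" using s unfolding I_def by blast
    ultimately show ?thesis by blast
  qed
  \<comment> \<open>The sum of \<open>I n\<close> and the ideal generated by \<open>X\<close>. It is
    proper because an element of \<open>I n\<close> with constant term 1 would have a monic
    reflection in \<open>Q n\<close>.\<close>
  define J where "J = {f \<in> polys_over R. \<exists>p\<in>I n. coeff f 0 = coeff p 0}"
  have In: "is_ideal_in (poly_ring R) (to_fract ` I n)" using primeD(1)[OF Iprime] by simp
  have I1: "p + q \<in> I n" if "p \<in> I n" "q \<in> I n" for p q
    using idealD(3)[OF In, of "to_fract p" "to_fract q"] that by (simp flip: to_fract_add)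
  have I2: "p * q \<in> I n" if "p \<in> polys_over R" "q \<in> I n" for p q
    using idealD(4)[OF In, of "to_fract p" "to_fract q"] that pr by (simp flip: to_fract_mult)
  have I0: "0 \<in> I n" using idealD(1)[OF In] by (simp flip: to_fract_0)
  have IJ: "I n \<subseteq> J" unfolding J_def I_def by blast
  have J: "is_ideal_in (poly_ring R) (to_fract ` J)"
  proof (rule poly_ideal_to_fract)
    show "J \<subseteq> polys_over R" unfolding J_def by blast
    show "0 \<in> J" using IJ I0 by blast
    show "p + q \<in> J" if "p \<in> J" "q \<in> J" for p q
      using that I1 P(3) unfolding J_def by (auto intro!: bexI[of _ "_ + _"])
    show "p * q \<in> J" if pq: "p \<in> polys_over R" "q \<in> J" for p q
    proof -
      obtain r where r: "r \<in> I n" "coeff q 0 = coeff r 0" using pq unfolding J_def by blast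
      then have "coeff (p * q) 0 = coeff (p * r) 0" by (simp add: coeff_mult)
      then show ?thesis using I2[OF pq(1) r(1)] pq P(5) unfolding J_def by blast
    qed
  qed
  have "1 \<notin> to_fract ` J"
  proof
    assume "1 \<in> to_fract ` J"
    then have "1 \<in> J" by (simp flip: to_fract_1)
    then obtain p where p: "p \<in> I n" "coeff p 0 = 1" unfolding J_def by auto
    then have "lead_coeff (reflect_poly p) = 1" by (simp add: coeff_reflect_poly)
    then have "reflect_poly p \<in> U_set R" using rp p(1) unfolding U_set_def I_def by simp
    then show False using p(1) disj[of n] unfolding I_def by blast
  qed
  \<comment> \<open>The valuation ring serves only to produce a prime ideal above \<open>J\<close>,
    namely its center.\<close>
  then obtain V where V: "valuation_ring_of UNIV V" "poly_ring R \<subseteq> V" "to_fract ` J \<subseteq> nonunits V"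
    using valuation_ring_exists[OF subfield_UNIV poly_ring_subring[OF R] _ J] by blast
  have top: "is_prime_in (poly_ring R) (nonunits V \<inter> poly_ring R)"
    using prime_contract[OF poly_ring_subring[OF R] valuation_ringD(1)[OF V(1)] V(2) nonunits_prime[OF subfield_UNIV V(1)]] .
  have "monom 1 1 \<in> J" unfolding J_def using mon by (auto intro!: bexI[OF _ I0])
  moreover have "reflect_poly (monom 1 1 :: 'a poly) = 1"
    by (simp add: poly_eq_iff coeff_reflect_poly degree_monom_eq) arith
  then have "monom 1 1 \<notin> I n" using primeD(5)[OF Qp[of n]] unfolding I_def by simp
  ultimately have "to_fract (monom 1 1) \<in> nonunits V \<inter> poly_ring R" "to_fract (monom 1 1) \<notin> to_fract ` I n"
    using V(3) mon pr by auto
  moreover have "to_fract ` I n \<subseteq> nonunits V \<inter> poly_ring R"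
    using IJ V(3) idealD(2)[OF In] by blast
  ultimately have "to_fract ` I n \<subset> nonunits V \<inter> poly_ring R" by blast
  then have "prime_chain (poly_ring R) (Suc n) ((\<lambda>i. to_fract ` I i)(Suc n := nonunits V \<inter> poly_ring R))"
    using Iprime top image_strict_mono[OF inj_to_fract Istrict]
    unfolding prime_chain_def by (auto simp: less_Suc_eq le_Suc_eq)
  then show ?thesis unfolding has_chain_def by blast
qed

subsection \<open>The multiplicative sets\<close>

definition poly_mult_set :: "'k::field set \<Rightarrow> 'k poly set \<Rightarrow> bool" where
  "poly_mult_set D S \<longleftrightarrow> S \<subseteq> polys_over D \<and> 0 \<notin> S \<and> 1 \<in> S \<and> (\<forall>p\<in>S. \<forall>q\<in>S. p * q \<in> S)"

lemma content_ideal_ideal: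
  assumes R: "is_subring R" and f: "f \<in> polys_over R"
  shows "is_ideal_in R (content_ideal R f)" "coeff f i \<in> content_ideal R f"
proof -
  note D = subringD[OF R]
  have c: "coeff f i \<in> R" for i using f unfolding polys_over_def by blast
  have CI: "(\<Sum>i\<le>degree f. r i * coeff f i) \<in> content_ideal R f" if "\<And>i. r i \<in> R" for r
    unfolding content_ideal_def using that by blast
  show id: "is_ideal_in R (content_ideal R f)"
    unfolding is_ideal_in_def
  proof (intro conjI ballI)
    show "content_ideal R f \<subseteq> R"
      unfolding content_ideal_def using c D by (auto intro!: subring_sum[OF R])
    show "0 \<in> content_ideal R f" using CI[of "\<lambda>_. 0"] D by simp
    fix x y assume y: "y \<in> content_ideal R f"
    then obtain s where s: "y = (\<Sum>i\<le>degree f. s i * coeff f i)" "\<forall>i. s i \<in> R"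
      unfolding content_ideal_def by blast
    show "x + y \<in> content_ideal R f" if "x \<in> content_ideal R f"
    proof -
      obtain r where r: "x = (\<Sum>i\<le>degree f. r i * coeff f i)" "\<forall>i. r i \<in> R"
        using \<open>x \<in> content_ideal R f\<close> unfolding content_ideal_def by blast
      then show ?thesis using CI[of "\<lambda>i. r i + s i"] s D by (simp add: distrib_right sum.distrib)
    qed
    show "x * y \<in> content_ideal R f" if "x \<in> R"
      using CI[of "\<lambda>i. x * s i"] s D that by (simp add: sum_distrib_left mult.assoc)
  qed
  show "coeff f i \<in> content_ideal R f"
  proof (cases "i \<le> degree f")
    case True
    have "(\<Sum>j\<le>degree f. (if j = i then 1 else 0) * coeff f j) = (\<Sum>j\<le>degree f. if j = i then coeff f j else 0)"
      by (intro sum.cong) auto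
    also have "\<dots> = coeff f i" using True by simp
    finally show ?thesis using CI[of "\<lambda>j. if j = i then 1 else 0"] D by simp
  next
    case False
    then show ?thesis using idealD(1)[OF id] by (simp add: coeff_eq_0)
  qed
qed

text \<open>A representation of 1 by the coefficients of \<open>f\<close> over \<open>R\<close>
  persists in \<open>V\<close>. The larger ring is allowed because primes of valuation overrings are
  tested as well.\<close>

lemma N_set_not_over_prime:
  assumes R: "is_subring R" "R \<subseteq> V" and P: "is_prime_in V P" and f: "f \<in> N_set R"
  shows "f \<notin> polys_over P"
proof
  assume p: "f \<in> polys_over P"
  have "1 \<in> content_ideal R f" using f subringD(2)[OF R(1)] unfolding N_set_def by simp
  then obtain r where r: "1 = (\<Sum>i\<le>degree f. r i * coeff f i)" "\<forall>i. r i \<in> R"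
    unfolding content_ideal_def by blast
  have "r i * coeff f i \<in> P" for i
    using idealD(4)[OF primeD(1)[OF P]] r(2) R(2) p unfolding polys_over_def by blast
  then have "1 \<in> P" unfolding r(1) by (intro ideal_sum[OF primeD(1)[OF P]])
  then show False using primeD(5)[OF P] by simp
qed

text \<open>If the content of \<open>f * g\<close> were proper, it would lie in a prime
  \<open>m\<close>, again the center of a valuation ring; then \<open>f\<close> or \<open>g\<close>
  would have all its coefficients in \<open>m\<close>.\<close>

lemma N_set_mult:
  assumes R: "is_subring R" and f: "f \<in> N_set R" and g: "g \<in> N_set R"
  shows "f * g \<in> N_set R"
proof (rule ccontr)
  assume no: "f * g \<notin> N_set R"
  have p: "f \<in> polys_over R" "g \<in> polys_over R" using f g unfolding N_set_def by auto
  have fg: "f * g \<in> polys_over R" using polys_over_ring(5)[OF R p] .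
  note C = content_ideal_ideal[OF R fg]
  have "content_ideal R (f * g) \<noteq> R" using no fg unfolding N_set_def by blast
  then have "1 \<notin> content_ideal R (f * g)"
    using idealD(2)[OF C(1)] idealD(5)[OF C(1), of 1] by auto
  then obtain V where V: "valuation_ring_of UNIV V" "R \<subseteq> V" "content_ideal R (f * g) \<subseteq> nonunits V"
    using valuation_ring_exists[OF subfield_UNIV R _ C(1)] by blast
  define m where "m = nonunits V \<inter> R"
  have m: "is_prime_in R m"
    unfolding m_def using prime_contract[OF R valuation_ringD(1)[OF V(1)] V(2) nonunits_prime[OF subfield_UNIV V(1)]] .
  have "f * g \<in> polys_over m"
    using C(2) idealD(2)[OF C(1)] V(3) unfolding m_def polys_over_def by blast
  then show False
    using polys_over_prime[OF R m p] N_set_not_over_prime[OF R subset_refl m] f g by blast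
qed

lemma U_set_subset_N_set:
  assumes R: "is_subring R"
  shows "U_set R \<subseteq> N_set R"
proof
  fix f assume f: "f \<in> U_set R"
  then have p: "f \<in> polys_over R" "1 = coeff f (degree f)" unfolding U_set_def by auto
  note C = content_ideal_ideal[OF R p(1)]
  have "1 \<in> content_ideal R f" using C(2)[of "degree f"] p(2) by simp
  then have "content_ideal R f = R"
    using idealD(2)[OF C(1)] idealD(5)[OF C(1), of 1] by auto
  then show "f \<in> N_set R" using p unfolding N_set_def by blast
qed

lemma poly_mult_sets:
  assumes R: "is_subring R"
  shows "poly_mult_set R {1}" "poly_mult_set R (A_set R)" "poly_mult_set R (U_set R)" "poly_mult_set R (N_set R)"
proof -
  note P = polys_over_ring[OF R]
  show "poly_mult_set R {1}" using P unfolding poly_mult_set_def by auto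
  show "poly_mult_set R (A_set R)" using P unfolding poly_mult_set_def A_set_def by auto
  show U: "poly_mult_set R (U_set R)" using P unfolding poly_mult_set_def U_set_def by (auto simp: lead_coeff_mult)
  have "0 \<notin> N_set R"
    using N_set_not_over_prime[OF R subset_refl prime_zero[OF R], of 0] by (auto simp: polys_over_def)
  then show "poly_mult_set R (N_set R)"
    using U U_set_subset_N_set[OF R] N_set_mult[OF R] unfolding poly_mult_set_def N_set_def by auto
qed

lemma poly_loc_ring:
  assumes R: "is_subring R" and S: "poly_mult_set R S"
  shows "mult_set (poly_ring R) (to_fract ` S)" "is_subring (poly_loc R S)" "poly_ring R \<subseteq> poly_loc R S"
    "quot_field (poly_loc R S) = quot_field (poly_ring R)"
proof -
  show M: "mult_set (poly_ring R) (to_fract ` S)"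
    using S unfolding poly_mult_set_def by (intro mult_set_to_fract) auto
  show "is_subring (poly_loc R S)" "poly_ring R \<subseteq> poly_loc R S"
    "quot_field (poly_loc R S) = quot_field (poly_ring R)"
    using localization_ring[OF poly_ring_subring[OF R] M] quot_field_localization[OF poly_ring_subring[OF R] M]
    unfolding poly_loc_eq by auto
qed

lemma poly_loc_one: "poly_loc R {1} = poly_ring R"
  unfolding poly_loc_def poly_ring_def by blast

section \<open>Transfer of chains between \<open>D\<close> and \<open>D[X]_S\<close>\<close>

text \<open>A constant term 1 lies in no prime, so \<open>S\<close> misses the extended primes as
  well as the additional top prime.\<close>

lemma has_chain_poly_loc_A:
  assumes R: "is_subring R" and S: "poly_mult_set R S" "S \<subseteq> A_set R" and ch: "has_chain R n"
  shows "has_chain (poly_loc R S) (Suc n)"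
proof -
  obtain P where P: "prime_chain R n P" using ch unfolding has_chain_def by blast
  have pr: "is_prime_in R (P i)" if "i \<le> n" for i using P that unfolding prime_chain_def by blast
  have c: "coeff f 0 = 1" if "f \<in> S" for f using S(2) that unfolding A_set_def by (auto simp: poly_0_coeff_0)
  have n1: "coeff f 0 \<notin> P i" if "f \<in> S" "i \<le> n" for f i using c[OF that(1)] primeD(5)[OF pr[OF that(2)]] by simp
  have top: "to_fract ` {f \<in> polys_over R. coeff f 0 \<in> P n} \<inter> to_fract ` S = {}"
    using n1[OF _ order_refl] by auto
  have low: "to_fract ` polys_over (P i) \<inter> to_fract ` S = {}" if "i \<le> n" for i
  proof -
    have "f \<notin> polys_over (P i)" if "f \<in> S" for f
      using n1[OF that \<open>i \<le> n\<close>] unfolding polys_over_def by blast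
    then show ?thesis by auto
  qed
  have "prime_chain (poly_loc R S) (Suc n) (\<lambda>i. localization
      (((\<lambda>i. to_fract ` polys_over (P i))(Suc n := to_fract ` {f \<in> polys_over R. coeff f 0 \<in> P n})) i)
      (to_fract ` S))"
    unfolding poly_loc_eq
    by (intro prime_chain_localization poly_ring_subring R poly_loc_ring(1) S(1) prime_chain_poly_ring_Suc P)
      (use top low in \<open>simp add: le_Suc_eq, blast\<close>)
  then show ?thesis unfolding has_chain_def by blast
qed

lemma has_chain_poly_loc_N:
  assumes R: "is_subring R" and S: "poly_mult_set R S" "S \<subseteq> N_set R" and ch: "has_chain R n"
  shows "has_chain (poly_loc R S) n"
proof -
  obtain P where P: "prime_chain R n P" using ch unfolding has_chain_def by blast
  have pr: "is_prime_in R (P i)" if "i \<le> n" for i using P that unfolding prime_chain_def by blast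
  have "to_fract ` polys_over (P i) \<inter> to_fract ` S = {}" if "i \<le> n" for i
    using N_set_not_over_prime[OF R subset_refl pr[OF that]] S(2) by auto
  then show ?thesis
    using prime_chain_localization[OF poly_ring_subring[OF R] poly_loc_ring(1)[OF R S(1)] prime_chain_poly_ring[OF R P]]
    unfolding has_chain_def poly_loc_eq by blast
qed

lemma has_chain_poly_ring_of_loc:
  assumes R: "is_subring R" and S: "poly_mult_set R S" and ch: "has_chain (poly_loc R S) n"
  shows "has_chain (poly_ring R) n"
  using ch prime_chain_contract_localization[OF poly_ring_subring[OF R] poly_loc_ring(1)[OF R S]]
  unfolding has_chain_def poly_loc_eq by blast

lemma has_chain_poly_ring_of_loc_U:
  assumes R: "is_subring R" and S: "poly_mult_set R S" "U_set R \<subseteq> S" and ch: "has_chain (poly_loc R S) n"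
  shows "has_chain (poly_ring R) (Suc n)"
proof -
  note L = poly_loc_ring[OF R S(1)]
  obtain Q where Q: "prime_chain (poly_loc R S) n Q" using ch unfolding has_chain_def by blast
  have "(Q i \<inter> poly_ring R) \<inter> to_fract ` U_set R = {}" if "i \<le> n" for i
    using localization_prime_disjoint[OF poly_ring_subring[OF R] L(1), of "Q i"] Q that S(2)
    unfolding prime_chain_def poly_loc_eq by blast
  then show ?thesis
    using has_chain_Suc_of_monic_disjoint[OF R, of n "\<lambda>i. Q i \<inter> poly_ring R"]
      prime_chain_contract_localization[OF poly_ring_subring[OF R] L(1)] Q unfolding poly_loc_eq by blast
qed

lemma poly_loc_subset_valuation_ring:
  assumes R: "is_subring R" and S: "poly_mult_set R S" and W: "valuation_ring_of F W" "poly_ring R \<subseteq> W"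
    and disj: "nonunits W \<inter> to_fract ` S = {}"
  shows "poly_loc R S \<subseteq> W"
proof
  fix x assume "x \<in> poly_loc R S"
  then obtain f s where x: "x = to_fract f / to_fract s" "f \<in> polys_over R" "s \<in> S"
    unfolding poly_loc_eq localization_def poly_ring_eq by blast
  then have "to_fract f \<in> W" "to_fract s \<in> W" using S W(2) unfolding poly_mult_set_def poly_ring_eq by auto
  moreover have "inverse (to_fract s) \<in> W" using disj x(3) \<open>to_fract s \<in> W\<close> by (auto simp: nonunits_def)
  ultimately show "x \<in> W" unfolding x(1) divide_inverse using subringD(5)[OF valuation_ringD(1)[OF W(1)]] by blast
qed

text \<open>Chains are lifted from \<open>V[X]\<close>, which lies between \<open>R[X]\<close> and
  its quotient field. The center on \<open>V[X]\<close> is kept in the conclusion because it decides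
  which polynomials become units of \<open>W\<close>.\<close>

lemma valuation_overring_poly_ring:
  assumes R: "is_subring R" and V: "valuation_ring_of (quot_field R) V" "R \<subseteq> V" and P: "prime_chain (poly_ring V) n P"
  obtains W where "valuation_ring_of (quot_field (poly_ring R)) W" "poly_ring R \<subseteq> W" "has_chain W n"
    "nonunits W \<inter> poly_ring V = P n"
proof -
  note VD = valuation_ringD[OF V(1)]
  have "poly_ring R \<subseteq> poly_ring V" using V(2) unfolding poly_ring_eq polys_over_def by blast
  moreover have "poly_ring V \<subseteq> poly_ring (quot_field R)" using VD(2) unfolding poly_ring_eq polys_over_def by blast
  then have "poly_ring V \<subseteq> quot_field (poly_ring R)" using quot_field_poly_ring(2)[OF R] by blast
  ultimately show thesis
    using prime_chain_lift[OF quot_field_subfield(1)[OF poly_ring_subring[OF R]] poly_ring_subring[OF VD(1)] _ P] that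
    unfolding has_chain_def by blast
qed

lemma has_vchain_poly_loc_A:
  assumes R: "is_subring R" and S: "poly_mult_set R S" "S \<subseteq> A_set R" and ch: "has_vchain R n"
  shows "has_vchain (poly_loc R S) (Suc n)"
proof -
  obtain V P where V: "valuation_ring_of (quot_field R) V" "R \<subseteq> V" and P: "prime_chain V n P"
    using ch unfolding has_vchain_def has_chain_def by blast
  have pr: "is_prime_in V (P n)" using P unfolding prime_chain_def by blast
  obtain W where W: "valuation_ring_of (quot_field (poly_ring R)) W" "poly_ring R \<subseteq> W" "has_chain W (Suc n)"
    "nonunits W \<inter> poly_ring V = to_fract ` {f \<in> polys_over V. coeff f 0 \<in> P n}"
    using valuation_overring_poly_ring[OF R V prime_chain_poly_ring_Suc[OF valuation_ringD(1)[OF V(1)] P]] by auto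
  have "to_fract s \<notin> nonunits W" if "s \<in> S" for s
  proof
    assume "to_fract s \<in> nonunits W"
    moreover have s: "s \<in> A_set R" using S(2) that by blast
    then have "to_fract s \<in> poly_ring V" using V(2) unfolding A_set_def poly_ring_eq polys_over_def by auto
    ultimately have "to_fract s \<in> to_fract ` {f \<in> polys_over V. coeff f 0 \<in> P n}" using W(4) by blast
    then have "coeff s 0 \<in> P n" by simp
    then show False using s primeD(5)[OF pr] unfolding A_set_def by (simp add: poly_0_coeff_0)
  qed
  then have "poly_loc R S \<subseteq> W" by (intro poly_loc_subset_valuation_ring[OF R S(1) W(1,2)]) blast
  then show ?thesis using W(1,3) unfolding has_vchain_def poly_loc_ring(4)[OF R S(1)] by blast
qed

lemma has_vchain_poly_loc_N:
  assumes R: "is_subring R" and S: "poly_mult_set R S" "S \<subseteq> N_set R" and ch: "has_vchain R n"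
  shows "has_vchain (poly_loc R S) n"
proof -
  obtain V P where V: "valuation_ring_of (quot_field R) V" "R \<subseteq> V" and P: "prime_chain V n P"
    using ch unfolding has_vchain_def has_chain_def by blast
  have pr: "is_prime_in V (P n)" using P unfolding prime_chain_def by blast
  obtain W where W: "valuation_ring_of (quot_field (poly_ring R)) W" "poly_ring R \<subseteq> W" "has_chain W n"
    "nonunits W \<inter> poly_ring V = to_fract ` polys_over (P n)"
    using valuation_overring_poly_ring[OF R V prime_chain_poly_ring[OF valuation_ringD(1)[OF V(1)] P]] by blast
  have "to_fract s \<notin> nonunits W" if "s \<in> S" for s
  proof
    assume "to_fract s \<in> nonunits W"
    moreover have s: "s \<in> N_set R" using S(2) that by blast
    then have "to_fract s \<in> poly_ring V" using V(2) unfolding N_set_def poly_ring_eq polys_over_def by auto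
    ultimately have "to_fract s \<in> to_fract ` polys_over (P n)" using W(4) by blast
    then show False using N_set_not_over_prime[OF R V(2) pr s] by simp
  qed
  then have "poly_loc R S \<subseteq> W" by (intro poly_loc_subset_valuation_ring[OF R S(1) W(1,2)]) blast
  then show ?thesis using W(1,3) unfolding has_vchain_def poly_loc_ring(4)[OF R S(1)] by blast
qed

lemma has_vchain_of_poly_loc:
  assumes R: "is_subring R" and S: "poly_mult_set R S" and ch: "has_vchain (poly_loc R S) (Suc n)"
  shows "has_vchain R n"
proof -
  note L = poly_loc_ring[OF R S]
  obtain W where W: "valuation_ring_of (quot_field (poly_ring R)) W" "poly_loc R S \<subseteq> W" "has_chain W (Suc n)"
    using ch unfolding has_vchain_def L(4) by blast
  have "to_fract [:a:] \<in> W" if "a \<in> R" for a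
    using W(2) L(3) polys_over_ring(7)[OF R that] unfolding poly_ring_eq by blast
  then show ?thesis using contraction_to_constants[OF R W(1) _ W(3)] by blast
qed

text \<open>Contraction to constants costs one step; refining \<open>W\<close> beforehand gains one,
  since the monic polynomials are units of \<open>W\<close>.\<close>

lemma has_vchain_of_poly_loc_U:
  assumes R: "is_subring R" and S: "poly_mult_set R S" "U_set R \<subseteq> S" and ch: "has_vchain (poly_loc R S) n"
  shows "has_vchain R n"
proof -
  note L = poly_loc_ring[OF R S(1)]
  obtain W where W: "valuation_ring_of (quot_field (poly_ring R)) W" "poly_loc R S \<subseteq> W" "has_chain W n"
    using ch unfolding has_vchain_def L(4) by blast
  have "inverse (to_fract g) \<in> W" if "g \<in> U_set R" for g
  proof -
    have "1 / to_fract g \<in> poly_loc R S"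
      unfolding poly_loc_eq using that S(2) subringD(2)[OF poly_ring_subring[OF R]] by (intro localizationI) auto
    then show ?thesis using W(2) by (auto simp: inverse_eq_divide)
  qed
  then obtain W' where "valuation_ring_of (quot_field (poly_ring R)) W'" "\<And>a. a \<in> R \<Longrightarrow> to_fract [:a:] \<in> W'"
    "has_chain W' (Suc n)"
    using has_chain_refine_monic_units[OF R W(1) _ _ W(3)] L(3) W(2) by blast
  then show ?thesis using contraction_to_constants[OF R] by blast
qed

subsection \<open>Jaffard domains\<close>

text \<open>Finite lower bounds determine an extended natural number, also when it is infinite. In
  this way constructions of chains turn into inequalities between dimensions.\<close>

lemma enat_le_by_nat:
  assumes "\<And>n. enat n \<le> a \<Longrightarrow> enat n \<le> b"
  shows "a \<le> b"
proof (rule ccontr)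
  assume "\<not> a \<le> b"
  then obtain k where k: "b = enat k" "enat k < a" by (cases b) auto
  then have "enat (Suc k) \<le> a" by (simp add: Suc_ile_eq)
  then have "enat (Suc k) \<le> enat k" using assms k(1) by blast
  then show False by simp
qed

lemma enat_add_one_le:
  assumes "\<And>n. enat n \<le> a \<Longrightarrow> enat (Suc n) \<le> b"
  shows "a + 1 \<le> b"
proof (rule enat_le_by_nat)
  fix n assume n: "enat n \<le> a + 1"
  show "enat n \<le> b"
  proof (cases n)
    case (Suc m)
    then have "enat m \<le> a" using n by (cases a) (auto simp: one_enat_def)
    then show ?thesis using assms Suc by blast
  qed (simp add: zero_enat_def[symmetric])
qed

lemma enat_le_add_one:
  assumes "\<And>n. enat (Suc n) \<le> b \<Longrightarrow> enat n \<le> a"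
  shows "b \<le> a + 1"
proof (rule enat_le_by_nat)
  fix n assume n: "enat n \<le> b"
  show "enat n \<le> a + 1"
  proof (cases n)
    case (Suc m)
    then have "enat m \<le> a" using n assms by blast
    then show ?thesis using Suc by (cases a) (auto simp: one_enat_def)
  qed (simp add: zero_enat_def[symmetric])
qed

lemma krull_dim_le_valuative_dim: "is_subring R \<Longrightarrow> krull_dim R \<le> valuative_dim R"
  by (rule enat_le_by_nat) (simp add: le_krull_dim_iff le_valuative_dim_iff has_chain_imp_has_vchain)

lemma dims_poly_loc_A:
  assumes R: "is_subring R" and S: "poly_mult_set R S" "S \<subseteq> A_set R"
  shows "valuative_dim (poly_loc R S) = valuative_dim R + 1" "krull_dim R + 1 \<le> krull_dim (poly_loc R S)"
proof -
  note L = poly_loc_ring(2)[OF R S(1)]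
  note * = le_krull_dim_iff[OF L] le_valuative_dim_iff[OF L] le_krull_dim_iff[OF R] le_valuative_dim_iff[OF R]
  have "valuative_dim (poly_loc R S) \<le> valuative_dim R + 1"
    by (rule enat_le_add_one) (use has_vchain_of_poly_loc[OF R S(1)] in \<open>simp add: *\<close>)
  moreover have "valuative_dim R + 1 \<le> valuative_dim (poly_loc R S)"
    by (rule enat_add_one_le) (use has_vchain_poly_loc_A[OF R S] in \<open>simp add: *\<close>)
  ultimately show "valuative_dim (poly_loc R S) = valuative_dim R + 1" by simp
  show "krull_dim R + 1 \<le> krull_dim (poly_loc R S)"
    by (rule enat_add_one_le) (use has_chain_poly_loc_A[OF R S] in \<open>simp add: *\<close>)
qed

lemma krull_dim_poly_loc_le:
  assumes R: "is_subring R" and S: "poly_mult_set R S"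
  shows "krull_dim (poly_loc R S) \<le> krull_dim (poly_ring R)"
  by (rule enat_le_by_nat) (use has_chain_poly_ring_of_loc[OF R S] in
      \<open>simp add: le_krull_dim_iff[OF poly_loc_ring(2)[OF R S]] le_krull_dim_iff[OF poly_ring_subring[OF R]]\<close>)

lemma dims_poly_loc_between_U_N:
  assumes R: "is_subring R" and S: "poly_mult_set R S" "U_set R \<subseteq> S" "S \<subseteq> N_set R"
  shows "valuative_dim (poly_loc R S) = valuative_dim R" "krull_dim R \<le> krull_dim (poly_loc R S)"
    "krull_dim (poly_loc R S) + 1 \<le> krull_dim (poly_ring R)"
proof -
  note L = poly_loc_ring(2)[OF R S(1)]
  note * = le_krull_dim_iff[OF L] le_valuative_dim_iff[OF L] le_krull_dim_iff[OF R] le_valuative_dim_iff[OF R]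
    le_krull_dim_iff[OF poly_ring_subring[OF R]]
  have "valuative_dim (poly_loc R S) \<le> valuative_dim R"
    by (rule enat_le_by_nat) (use has_vchain_of_poly_loc_U[OF R S(1,2)] in \<open>simp add: *\<close>)
  moreover have "valuative_dim R \<le> valuative_dim (poly_loc R S)"
    by (rule enat_le_by_nat) (use has_vchain_poly_loc_N[OF R S(1,3)] in \<open>simp add: *\<close>)
  ultimately show "valuative_dim (poly_loc R S) = valuative_dim R" by simp
  show "krull_dim R \<le> krull_dim (poly_loc R S)"
    by (rule enat_le_by_nat) (use has_chain_poly_loc_N[OF R S(1,3)] in \<open>simp add: *\<close>)
  show "krull_dim (poly_loc R S) + 1 \<le> krull_dim (poly_ring R)"
    by (rule enat_add_one_le) (use has_chain_poly_ring_of_loc_U[OF R S(1,2)] in \<open>simp add: *\<close>)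
qed

text \<open>A squeeze: \<open>dim D + 1 \<le> dim D[X] \<le> dim_v D[X] = dim_v D + 1\<close>, where
  the outer terms agree for a Jaffard domain.\<close>

lemma krull_dim_poly_ring_of_jaffard:
  assumes R: "is_subring R" and J: "jaffard R"
  shows "krull_dim (poly_ring R) = 1 + krull_dim R"
proof -
  have "{1} \<subseteq> A_set R" using polys_over_ring(2)[OF R] unfolding A_set_def by simp
  note A = dims_poly_loc_A[OF R poly_mult_sets(1)[OF R] this, unfolded poly_loc_one]
  have "krull_dim (poly_ring R) \<le> krull_dim R + 1"
    using krull_dim_le_valuative_dim[OF poly_ring_subring[OF R]] A(1) J unfolding jaffard_def by simp
  then show ?thesis using A(2) by (simp add: add.commute)
qed

text \<open>Forward, \<open>dim D[X]_S\<close> is squeezed between \<open>dim D + 1\<close> and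
  \<open>dim_v D + 1\<close>. Backward,
  \<open>dim_v D + 1 = dim D[X]_S \<le> dim D[X] = 1 + dim D\<close>, and 1 cancels because the left
  side is finite. The choice \<open>S = {1}\<close> covers \<open>D[X]\<close> itself.\<close>

lemma jaffard_iff_poly_loc_A:
  assumes R: "is_subring R" and S: "poly_mult_set R S" "S \<subseteq> A_set R"
  shows "jaffard R \<longleftrightarrow> jaffard (poly_loc R S) \<and> krull_dim (poly_ring R) = 1 + krull_dim R"
proof
  note A = dims_poly_loc_A[OF assms] and le = krull_dim_le_valuative_dim[OF poly_loc_ring(2)[OF R S(1)]]
  show "jaffard (poly_loc R S) \<and> krull_dim (poly_ring R) = 1 + krull_dim R" if J: "jaffard R"
  proof
    have "krull_dim (poly_loc R S) = valuative_dim (poly_loc R S)" using J A le unfolding jaffard_def by simp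
    moreover obtain k where "valuative_dim R = enat k" using J less_infinityE unfolding jaffard_def by blast
    then have "valuative_dim (poly_loc R S) < \<infinity>" using A(1) by (simp add: one_enat_def)
    ultimately show "jaffard (poly_loc R S)" unfolding jaffard_def by simp
  qed (rule krull_dim_poly_ring_of_jaffard[OF R J])
  assume "jaffard (poly_loc R S) \<and> krull_dim (poly_ring R) = 1 + krull_dim R"
  then have *: "valuative_dim R + 1 < \<infinity>" "valuative_dim R + 1 \<le> 1 + krull_dim R"
    using A(1) krull_dim_poly_loc_le[OF R S(1)] unfolding jaffard_def by metis+
  have fin: "valuative_dim R < \<infinity>" using *(1) by (cases "valuative_dim R") auto
  have "valuative_dim R \<le> krull_dim R"
    using *(2) fin by (cases "valuative_dim R"; cases "krull_dim R") (auto simp: one_enat_def)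
  then show "jaffard R" using fin krull_dim_le_valuative_dim[OF R] unfolding jaffard_def by simp
qed

text \<open>Backward, \<open>dim_v D + 1 = dim D[X]_S + 1 \<le> dim D[X] = 1 + dim D\<close>; the
  summand 1 after \<open>dim D[X]_S\<close> is what reversal of polynomials provides.\<close>

lemma jaffard_iff_poly_loc_between_U_N:
  assumes R: "is_subring R" and S: "poly_mult_set R S" "U_set R \<subseteq> S" "S \<subseteq> N_set R"
  shows "jaffard R \<longleftrightarrow> jaffard (poly_loc R S) \<and> krull_dim (poly_ring R) = 1 + krull_dim R"
proof
  note A = dims_poly_loc_between_U_N[OF assms] and le = krull_dim_le_valuative_dim[OF poly_loc_ring(2)[OF R S(1)]]
  show "jaffard (poly_loc R S) \<and> krull_dim (poly_ring R) = 1 + krull_dim R" if J: "jaffard R"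
    using J A(1,2) le krull_dim_poly_ring_of_jaffard[OF R J] unfolding jaffard_def by (metis order_antisym)
  assume "jaffard (poly_loc R S) \<and> krull_dim (poly_ring R) = 1 + krull_dim R"
  then have fin: "valuative_dim R < \<infinity>" and "valuative_dim R + 1 \<le> krull_dim R + 1"
    using A(1,3) unfolding jaffard_def by (auto simp: add.commute)
  then have "valuative_dim R \<le> krull_dim R"
    by (cases "valuative_dim R"; cases "krull_dim R") (auto simp: one_enat_def)
  then show "jaffard R" using fin krull_dim_le_valuative_dim[OF R] unfolding jaffard_def by simp
qed

theorem mainTheorem8:
  fixes D :: "'k::field set"
  assumes "is_subring D"
  shows "(jaffard D
            \<longleftrightarrow> jaffard (poly_ring D) \<and> krull_dim (poly_ring D) = 1 + krull_dim D)
       \<and> (jaffard D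
            \<longleftrightarrow> jaffard (poly_loc D (A_set D)) \<and> krull_dim (poly_ring D) = 1 + krull_dim D)
       \<and> (jaffard D
            \<longleftrightarrow> jaffard (poly_loc D (U_set D)) \<and> krull_dim (poly_ring D) = 1 + krull_dim D)
       \<and> (jaffard D
            \<longleftrightarrow> jaffard (poly_loc D (N_set D)) \<and> krull_dim (poly_ring D) = 1 + krull_dim D)"
proof -
  note M = poly_mult_sets[OF assms] and UN = U_set_subset_N_set[OF assms]
  have "{1} \<subseteq> A_set D" using polys_over_ring(2)[OF assms] unfolding A_set_def by simp
  note 1 = jaffard_iff_poly_loc_A[OF assms M(1) this, unfolded poly_loc_one]
  note 2 = jaffard_iff_poly_loc_A[OF assms M(2) subset_refl]
  note 3 = jaffard_iff_poly_loc_between_U_N[OF assms M(3) subset_refl UN]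
  note 4 = jaffard_iff_poly_loc_between_U_N[OF assms M(4) UN subset_refl]
  show ?thesis by (intro conjI 1 2 3 4)
qed

end
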